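(* For every $k\ge3$, the noncommutative prism $\mathrm P(k)_{\mathrm{nc}}$ and the noncommutative state space $S_{\mathrm{nc}}(\mathrm{NCP}(k))$ admit noncommutative extreme points at every finite graded level.
   Context: Let $w,v$ be the canonical unitaries in the full group C$^*$-algebra $\mathrm C^*(\mathbb Z_k*\mathbb Z_2)$ of the free product, arising from the generators of $\mathbb Z_k$ and $\mathbb Z_2$. $\mathrm{NCP}(k)=\mathrm{Span}\{1,w,w^2,\dots,w^{k-1},v\}$. Put $\mathrm P(k)_{\mathrm{nc}}=W_{\mathrm{nc}}(w,v)=\bigsqcup_{n\le\aleph_0}W_n(w,v)$, where $W_n(w,v)=\{(\phi(w),\phi(v)):\phi:\mathrm{Span}\{1,w,w^*,v\}\to\mathcal B(\ell^2(n))\text{ unital completely positive}\}$. For a finite-dimensional operator system $\mathcal R$, $S_{\mathrm{nc}}(\mathcal R)=\bigsqcup_{n\le\aleph_0}S_n(\mathcal R)$, where $S_n(\mathcal R)$ is the set of unital completely positive maps $\mathcal R\to\mathcal B(\ell^2(n))$. Let $K_{\mathrm{nc}}=\bigsqcup_{n\le\aleph_0}K_n$ be a noncommutative convex set (a graded set closed under direct sums and compressions by isometries), such as these. An element $x\in K_n$ is pure if, whenever $x=\sum_j\gamma_j^*x_j\gamma_j$ with $x_j\in K_{n_j}$ and $\{\gamma_j\}_j$ a bounded family of nonzero operators $\gamma_j:\ell^2(n)\to\ell^2(n_j)$ with $\sum_j\gamma_j^*\gamma_j=1$, each $\gamma_j$ is a scalar multiple of an isometry $\nu_j$ and $\nu_j^*x_j\nu_j=x$.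 An element $x\in K_n$ is maximal if the only elements of $K_{\mathrm{nc}}$ of the form $\begin{bmatrix} x & z_{12} \\ z_{21} & z_{22} \end{bmatrix}$ are those with $z_{12}=0$, $z_{21}=0$ and $z_{22}\in K_{\mathrm{nc}}$. A noncommutative extreme point is an element that is both pure and maximal. *)

theory Defs
  imports
    "HOL-Analysis.Analysis"
    "HOL-Algebra.Elementary_Groups"
    "HOL-Library.Function_Algebras"
    "HOL-Library.Extended_Nat"
begin

section \<open>The Hilbert space of square-summable sequences\<close>

typedef ell2 = "{x :: nat \<Rightarrow> complex. summable (\<lambda>i. (cmod (x i))\<^sup>2)}"
  morphisms coord Abs_ell2
  by (rule exI[of _ "\<lambda>_. 0"]) simp

setup_lifting type_definition_ell2

lemma summable_coord: "summable (\<lambda>i. (cmod (coord x i))\<^sup>2)"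
  using coord[of x] by simp

lemma summable_cnj_mult:
  fixes x y :: "nat \<Rightarrow> complex"
  assumes "summable (\<lambda>i. (cmod (x i))\<^sup>2)" "summable (\<lambda>i. (cmod (y i))\<^sup>2)"
  shows "summable (\<lambda>i. cnj (x i) * y i)"
proof (rule summable_comparison_test)
  show "summable (\<lambda>i. (cmod (x i))\<^sup>2 + (cmod (y i))\<^sup>2)"
    by (rule summable_add[OF assms])
  have "cmod (cnj (x n) * y n) \<le> (cmod (x n))\<^sup>2 + (cmod (y n))\<^sup>2" for n
  proof -
    have "2 * cmod (x n) * cmod (y n) \<le> (cmod (x n))\<^sup>2 + (cmod (y n))\<^sup>2"
      by (rule sum_squares_bound)
    moreover have "0 \<le> cmod (x n) * cmod (y n)" by simp
    ultimately show ?thesis unfolding norm_mult complex_mod_cnj by linarith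
  qed
  then show "\<exists>N. \<forall>n\<ge>N. norm (cnj (x n) * y n) \<le> (cmod (x n))\<^sup>2 + (cmod (y n))\<^sup>2"
    by blast
qed

lemma summable_sq_add:
  fixes x y :: "nat \<Rightarrow> complex"
  assumes "summable (\<lambda>i. (cmod (x i))\<^sup>2)" "summable (\<lambda>i. (cmod (y i))\<^sup>2)"
  shows "summable (\<lambda>i. (cmod (x i + y i))\<^sup>2)"
proof (rule summable_comparison_test)
  show "summable (\<lambda>i. 2 * (cmod (x i))\<^sup>2 + 2 * (cmod (y i))\<^sup>2)"
    by (intro summable_add summable_mult assms)
  have "(cmod (x n + y n))\<^sup>2 \<le> 2 * (cmod (x n))\<^sup>2 + 2 * (cmod (y n))\<^sup>2" for n
  proof -
    have "(cmod (x n + y n))\<^sup>2 \<le> (cmod (x n) + cmod (y n))\<^sup>2"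
      by (intro power_mono norm_triangle_ineq norm_ge_zero)
    also have "\<dots> \<le> 2 * (cmod (x n))\<^sup>2 + 2 * (cmod (y n))\<^sup>2"
      using sum_squares_bound[of "cmod (x n)" "cmod (y n)"] by (simp add: power2_sum)
    finally show ?thesis .
  qed
  then show "\<exists>N. \<forall>n\<ge>N. norm ((cmod (x n + y n))\<^sup>2) \<le> 2 * (cmod (x n))\<^sup>2 + 2 * (cmod (y n))\<^sup>2"
    by simp
qed

instantiation ell2 :: real_vector
begin

lift_definition zero_ell2 :: ell2 is "\<lambda>_. 0" by simp
lift_definition plus_ell2 :: "ell2 \<Rightarrow> ell2 \<Rightarrow> ell2" is "\<lambda>x y i. x i + y i"
  by (rule summable_sq_add)
lift_definition uminus_ell2 :: "ell2 \<Rightarrow> ell2" is "\<lambda>x i. - x i" by simp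
lift_definition minus_ell2 :: "ell2 \<Rightarrow> ell2 \<Rightarrow> ell2" is "\<lambda>x y i. x i - y i"
  subgoal for x y using summable_sq_add[of x "\<lambda>i. - y i"] by simp
  done
lift_definition scaleR_ell2 :: "real \<Rightarrow> ell2 \<Rightarrow> ell2" is "\<lambda>r x i. of_real r * x i"
  by (simp add: norm_mult power_mult_distrib summable_mult)

instance
  by standard (transfer, simp add: fun_eq_iff algebra_simps)+

end

lift_definition scaleC :: "complex \<Rightarrow> ell2 \<Rightarrow> ell2" is "\<lambda>c x i. c * x i"
  by (simp add: norm_mult power_mult_distrib summable_mult)

text \<open>The complex inner product is linear in the \<^emph>\<open>second\<close> argument. The library inner product
  \<open>\<bullet>\<close> of the type is its real part, so that the library norm is the Hilbert space norm.\<close>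

definition cinner :: "ell2 \<Rightarrow> ell2 \<Rightarrow> complex" where
  "cinner x y = (\<Sum>i. cnj (coord x i) * coord y i)"

lemma cinner_sums: "(\<lambda>i. cnj (coord x i) * coord y i) sums cinner x y"
  unfolding cinner_def by (intro summable_sums summable_cnj_mult summable_coord)

lemma cinner_add_left: "cinner (x + y) z = cinner x z + cinner y z"
  using sums_add[OF cinner_sums[of x z] cinner_sums[of y z]] cinner_sums[of "x + y" z]
  by (simp add: plus_ell2.rep_eq algebra_simps sums_iff)

lemma cinner_cnj: "cinner y x = cnj (cinner x y)"
proof -
  have "(\<lambda>i. cnj (cnj (coord x i) * coord y i)) sums cnj (cinner x y)"
    using cinner_sums[of x y] by (simp only: sums_cnj)
  then show ?thesis
    using cinner_sums[of y x] by (simp add: sums_iff mult.commute)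
qed

lemma cinner_add_right: "cinner x (y + z) = cinner x y + cinner x z"
  by (metis cinner_add_left cinner_cnj complex_cnj_add)

lemma cinner_scaleC_right: "cinner x (scaleC c y) = c * cinner x y"
  using sums_mult[OF cinner_sums[of x y], of c] cinner_sums[of x "scaleC c y"]
  by (simp add: scaleC.rep_eq algebra_simps sums_iff)

lemma cinner_scaleC_left: "cinner (scaleC c x) y = cnj c * cinner x y"
  by (metis cinner_scaleC_right cinner_cnj complex_cnj_mult)

lemma scaleR_scaleC: "r *\<^sub>R x = scaleC (of_real r) x"
  by transfer simp

lemma cinner_self_sums: "(\<lambda>i. (cmod (coord x i))\<^sup>2) sums Re (cinner x x)"
proof -
  have "Re (cnj z * z) = (cmod z)\<^sup>2" for z
    by (simp add: cmod_power2) (simp add: power2_eq_square)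
  then show ?thesis
    using sums_Re[OF cinner_sums[of x x]] by simp
qed

lemma Re_cinner_self_eq_0: "Re (cinner x x) = 0 \<longleftrightarrow> x = 0"
proof
  assume "Re (cinner x x) = 0"
  then have "(\<Sum>i. (cmod (coord x i))\<^sup>2) = 0"
    using cinner_self_sums[of x] by (simp add: sums_iff)
  then have "\<forall>i. (cmod (coord x i))\<^sup>2 = 0"
    using suminf_eq_zero_iff[OF summable_coord] by fastforce
  then show "x = 0" by (simp add: coord_inject[symmetric] zero_ell2.rep_eq fun_eq_iff)
next
  assume "x = 0"
  then show "Re (cinner x x) = 0" by (simp add: cinner_def zero_ell2.rep_eq)
qed

instantiation ell2 :: real_inner
begin

definition inner_ell2 :: "ell2 \<Rightarrow> ell2 \<Rightarrow> real" where "inner_ell2 x y = Re (cinner x y)"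
definition norm_ell2 :: "ell2 \<Rightarrow> real" where "norm_ell2 x = sqrt (inner x x)"
definition dist_ell2 :: "ell2 \<Rightarrow> ell2 \<Rightarrow> real" where "dist_ell2 x y = norm (x - y)"
definition sgn_ell2 :: "ell2 \<Rightarrow> ell2" where "sgn_ell2 x = inverse (norm x) *\<^sub>R x"
definition uniformity_ell2 :: "(ell2 \<times> ell2) filter" where
  "uniformity_ell2 = (INF e\<in>{0<..}. principal {(x, y). dist x y < e})"
definition open_ell2 :: "ell2 set \<Rightarrow> bool" where
  "open_ell2 U \<longleftrightarrow> (\<forall>x\<in>U. \<forall>\<^sub>F (x', y) in uniformity. x' = x \<longrightarrow> y \<in> U)"

instance
proof
  fix x y z :: ell2 and r :: real
  show "inner x y = inner y x"
    unfolding inner_ell2_def by (subst cinner_cnj) simp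
  show "inner (x + y) z = inner x z + inner y z"
    by (simp add: inner_ell2_def cinner_add_left)
  show "inner (r *\<^sub>R x) y = r * inner x y"
    by (simp add: inner_ell2_def scaleR_scaleC cinner_scaleC_left)
  show "0 \<le> inner x x"
    unfolding inner_ell2_def using cinner_self_sums[of x] by (metis sums_iff suminf_nonneg zero_le_power2)
  show "(inner x x = 0) = (x = 0)"
    by (simp add: inner_ell2_def Re_cinner_self_eq_0)
qed (simp_all add: norm_ell2_def dist_ell2_def sgn_ell2_def uniformity_ell2_def open_ell2_def)

end

lemma cinner_self: "cinner x x = of_real ((norm x)\<^sup>2)"
proof -
  have "Im (cinner x x) = - Im (cinner x x)"
    using arg_cong[OF cinner_cnj[of x x], of Im] by simp
  moreover have "(norm x)\<^sup>2 = Re (cinner x x)"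
    by (metis inner_ell2_def power2_norm_eq_inner)
  ultimately show ?thesis by (simp add: complex_eq_iff)
qed

lemma norm_scaleC: "norm (scaleC c x) = cmod c * norm x"
proof -
  have "complex_of_real ((norm (scaleC c x))\<^sup>2) = cnj c * c * of_real ((norm x)\<^sup>2)"
    by (simp only: cinner_self[symmetric] cinner_scaleC_left cinner_scaleC_right mult_ac)
  also have "\<dots> = of_real ((cmod c * norm x)\<^sup>2)"
    by (simp add: power_mult_distrib complex_norm_square mult.commute del: of_real_power)
  finally have "(norm (scaleC c x))\<^sup>2 = (cmod c * norm x)\<^sup>2"
    using of_real_eq_iff by blast
  then show ?thesis by (simp add: power2_eq_iff_nonneg)
qed

lemma norm_cinner: "cmod (cinner x y) \<le> norm x * norm y"
proof (cases "cinner x y = 0")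
  case False
  define c where "c = cnj (cinner x y) / cmod (cinner x y)"
  have c: "cmod c = 1" using False by (simp add: c_def norm_divide)
  have "cinner x (scaleC c y) = of_real (cmod (cinner x y))"
  proof -
    have "cinner x (scaleC c y) = (cinner x y * cnj (cinner x y)) / cmod (cinner x y)"
      by (simp add: cinner_scaleC_right c_def)
    also have "cinner x y * cnj (cinner x y) = of_real (cmod (cinner x y)) * of_real (cmod (cinner x y))"
      by (simp only: complex_norm_square[symmetric]) (simp add: power2_eq_square)
    finally show ?thesis using False by simp
  qed
  then have "cmod (cinner x y) = inner x (scaleC c y)" by (simp add: inner_ell2_def)
  also have "\<dots> \<le> norm x * norm (scaleC c y)" by (rule norm_cauchy_schwarz)
  finally show ?thesis by (simp add: norm_scaleC c)
qed simp


section \<open>Bounded operators\<close>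

text \<open>For \<open>n :: enat\<close>, the space $\ell^2(n)$ is the closed subspace of sequences supported on the
  first \<open>n\<close> indices, so \<open>n = \<infinity>\<close> is the level $\aleph_0$. A bounded operator
  $\ell^2(n) \to \ell^2(m)$ is extended by \<open>0\<close> to the orthogonal complement of $\ell^2(n)$; the
  identity of $\ell^2(n)$ thereby becomes the projection \<open>idop n\<close>. Elements of the type \<open>op\<close> are
  a priori only real-linear; see \<open>clinear_op\<close> below.\<close>

type_synonym op = "ell2 \<Rightarrow>\<^sub>L ell2"

lift_definition trunc :: "enat \<Rightarrow> ell2 \<Rightarrow> ell2" is "\<lambda>n x i. if enat i < n then x i else 0"
  subgoal for n x by (rule summable_comparison_test[of _ "\<lambda>i. (cmod (x i))\<^sup>2"]) auto
  done

lemma norm_trunc_le: "norm (trunc n x) \<le> norm x"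
proof -
  have "Re (cinner (trunc n x) (trunc n x)) \<le> Re (cinner x x)"
    by (rule sums_le[OF _ cinner_self_sums cinner_self_sums]) (simp add: trunc.rep_eq)
  then show ?thesis by (simp add: norm_ell2_def inner_ell2_def)
qed

lemma bounded_linear_trunc: "bounded_linear (trunc n)"
proof (rule bounded_linear_intro[where K = 1])
  show "trunc n (x + y) = trunc n x + trunc n y" for x y by transfer auto
  show "trunc n (r *\<^sub>R x) = r *\<^sub>R trunc n x" for r x by transfer auto
  show "norm (trunc n x) \<le> norm x * 1" for x by (simp add: norm_trunc_le)
qed

lift_definition idop :: "enat \<Rightarrow> op" is trunc
  by (rule bounded_linear_trunc)

lemma scaleC_simps:
  "scaleC c (x + y) = scaleC c x + scaleC c y" "scaleC (c + d) x = scaleC c x + scaleC d x"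
  "scaleC c (scaleC d x) = scaleC (c * d) x" "scaleC 1 x = x"
  by (transfer, simp add: algebra_simps)+

lemma bounded_linear_scaleC: "bounded_linear (scaleC c)"
proof (rule bounded_linear_intro[where K = "cmod c"])
  show "scaleC c (x + y) = scaleC c x + scaleC c y" for x y by transfer (auto simp: algebra_simps)
  show "scaleC c (r *\<^sub>R x) = r *\<^sub>R scaleC c x" for r x by transfer auto
  show "norm (scaleC c x) \<le> norm x * cmod c" for x by (simp add: norm_scaleC)
qed

definition scale_op :: "complex \<Rightarrow> op \<Rightarrow> op" where
  "scale_op c T = Blinfun (scaleC c) o\<^sub>L T"

lemma scale_op_apply: "scale_op c T x = scaleC c (T x)"
  by (simp add: scale_op_def bounded_linear_Blinfun_apply[OF bounded_linear_scaleC])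

definition clinear_op :: "op \<Rightarrow> bool" where
  "clinear_op T \<longleftrightarrow> (\<forall>c x. T (scaleC c x) = scaleC c (T x))"

text \<open>\<open>bop n m\<close> is $\mathcal B(\ell^2(n), \ell^2(m))$.\<close>

definition bop :: "enat \<Rightarrow> enat \<Rightarrow> op set" where
  "bop n m = {T. clinear_op T \<and> T o\<^sub>L idop n = T \<and> idop m o\<^sub>L T = T}"

definition adj :: "op \<Rightarrow> op" where
  "adj T = (THE S :: op. \<forall>x y. cinner (T x) y = cinner x (S y))"

lemma cinner_eqI:
  assumes "\<And>x. cinner x y = cinner x z"
  shows "y = z"
proof -
  have "cinner x (y - z) = 0" for x
    using assms[of x] cinner_add_right[of x "y - z" z] by simp
  then show ?thesis using Re_cinner_self_eq_0[of "y - z"] by simp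
qed

lift_definition basis_vec :: "nat \<Rightarrow> ell2" is "\<lambda>i j. if j = i then 1 else 0"
  subgoal for i by (rule summable_finite[of "{i}"]) auto
  done

lemma cinner_basis_left: "cinner (basis_vec i) y = coord y i"
proof -
  have "(\<lambda>j. cnj (coord (basis_vec i) j) * coord y j) = (\<lambda>j. if j = i then coord y j else 0)"
    by (auto simp: basis_vec.rep_eq)
  then show ?thesis
    unfolding cinner_def using sums_single[of i "coord y"] by (simp add: sums_iff)
qed

lemma cinner_sum_right: "cinner x (sum f A) = (\<Sum>a\<in>A. cinner x (f a))"
proof (induction A rule: infinite_finite_induct)
  case (insert a A)
  then show ?case by (simp add: cinner_add_right)
qed (use cinner_add_right[of x 0 0] in simp_all)

lemma trunc_enat_sum: "trunc (enat N) x = (\<Sum>i<N. scaleC (coord x i) (basis_vec i))"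
proof -
  have "coord (\<Sum>i<N. scaleC (coord x i) (basis_vec i)) j = (if j < N then coord x j else 0)" for j
    by (simp only: cinner_basis_left[symmetric] cinner_sum_right cinner_scaleC_right)
      (simp add: cinner_basis_left basis_vec.rep_eq if_distrib sum.delta' cong: if_cong)
  then show ?thesis by (simp add: coord_inject[symmetric] trunc.rep_eq fun_eq_iff)
qed

lemma trunc_tendsto: "(\<lambda>N. trunc (enat N) x) \<longlonglongrightarrow> x"
proof -
  have eq: "(norm (x - trunc (enat N) x))\<^sup>2 = (norm x)\<^sup>2 - (\<Sum>i<N. (cmod (coord x i))\<^sup>2)" for N
  proof -
    have *: "(norm y)\<^sup>2 = Re (cinner y y)" for y
      by (simp add: cinner_self)
    let ?f = "\<lambda>i. (cmod (coord x i))\<^sup>2"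
    have "(\<lambda>i. ?f i - (if i < N then ?f i else 0)) sums (Re (cinner x x) - (\<Sum>i<N. ?f i))"
      using sums_If_finite_set[of "{..<N}" ?f] by (intro sums_diff cinner_self_sums) simp
    moreover have "(\<lambda>i. ?f i - (if i < N then ?f i else 0))
        = (\<lambda>i. (cmod (coord (x - trunc (enat N) x) i))\<^sup>2)"
      by (auto simp: minus_ell2.rep_eq trunc.rep_eq)
    ultimately show ?thesis
      using cinner_self_sums[of "x - trunc (enat N) x"] by (simp add: * sums_iff)
  qed
  have "(\<lambda>N. \<Sum>i<N. (cmod (coord x i))\<^sup>2) \<longlonglongrightarrow> (norm x)\<^sup>2"
    using cinner_self_sums[of x] by (simp add: sums_def cinner_self)
  then have "(\<lambda>N. (norm x)\<^sup>2 - (\<Sum>i<N. (cmod (coord x i))\<^sup>2)) \<longlonglongrightarrow> (norm x)\<^sup>2 - (norm x)\<^sup>2"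
    by (intro tendsto_intros)
  then have "(\<lambda>N. sqrt ((norm (x - trunc (enat N) x))\<^sup>2)) \<longlonglongrightarrow> sqrt 0"
    unfolding eq by (intro tendsto_intros) simp
  then have "(\<lambda>N. x - trunc (enat N) x) \<longlonglongrightarrow> 0"
    by (simp add: tendsto_norm_zero_iff)
  then have "(\<lambda>N. x - (x - trunc (enat N) x)) \<longlonglongrightarrow> x - 0"
    by (intro tendsto_intros)
  then show ?thesis by simp
qed

lemma cinner_right_cong_tendsto:
  assumes "f \<longlonglongrightarrow> (y :: ell2)"
  shows "(\<lambda>N. cinner x (f N)) \<longlonglongrightarrow> cinner x y"
proof (rule Lim_transform_eventually[of "\<lambda>N. cinner x y + cinner x (f N - y)"])
  have "(\<lambda>N. norm (f N - y)) \<longlonglongrightarrow> 0"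
    by (rule tendsto_norm_zero[OF LIM_zero[OF assms]])
  then have "(\<lambda>N. norm x * norm (f N - y)) \<longlonglongrightarrow> 0"
    by (rule tendsto_mult_right_zero)
  then have "(\<lambda>N. cinner x (f N - y)) \<longlonglongrightarrow> 0"
    by (rule Lim_null_comparison[rotated]) (rule always_eventually, rule allI, rule norm_cinner)
  then show "(\<lambda>N. cinner x y + cinner x (f N - y)) \<longlonglongrightarrow> cinner x y"
    using tendsto_add[OF tendsto_const, of "\<lambda>N. cinner x (f N - y)" 0 sequentially "cinner x y"]
    by simp
  show "\<forall>\<^sub>F N in sequentially. cinner x y + cinner x (f N - y) = cinner x (f N)"
    by (simp add: cinner_add_right[symmetric])
qed

text \<open>The definite description in \<open>adj\<close> is justified for complex-linear operators.\<close>

lemma adj_ex1: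
  assumes T: "clinear_op T"
  shows "\<exists>!S :: op. \<forall>x y. cinner (T x) y = cinner x (S y)"
proof -
  have trunc_S: "cinner (T (trunc (enat N) x)) y
      = (\<Sum>i<N. cnj (coord x i) * cinner (T (basis_vec i)) y)" for N x y
  proof -
    have "T (trunc (enat N) x) = (\<Sum>i<N. scaleC (coord x i) (T (basis_vec i)))"
      using T by (simp add: trunc_enat_sum blinfun.sum_right clinear_op_def)
    then show ?thesis
      by (subst cinner_cnj)
        (simp add: cinner_sum_right cinner_scaleC_right cinner_cnj[symmetric])
  qed
  have sq: "(\<Sum>i<N. (cmod (cinner (T (basis_vec i)) y))\<^sup>2) \<le> (norm T * norm y)\<^sup>2" for N y
  proof -
    define s where "s = (\<Sum>i<N. (cmod (cinner (T (basis_vec i)) y))\<^sup>2)"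
    define z where "z = (\<Sum>i<N. scaleC (cinner (T (basis_vec i)) y) (basis_vec i))"
    have cz: "coord z j = (if j < N then cinner (T (basis_vec j)) y else 0)" for j
      unfolding z_def
      by (simp only: cinner_basis_left[symmetric] cinner_sum_right cinner_scaleC_right)
        (simp add: cinner_basis_left basis_vec.rep_eq if_distrib sum.delta' cong: if_cong)
    have tz: "trunc (enat N) z = z"
      by (simp add: coord_inject[symmetric] trunc.rep_eq fun_eq_iff cz)
    have nz: "(norm z)\<^sup>2 = s"
    proof -
      have "(\<lambda>i. (cmod (coord z i))\<^sup>2) sums s"
        unfolding s_def using sums_If_finite_set[of "{..<N}" "\<lambda>i. (cmod (cinner (T (basis_vec i)) y))\<^sup>2"]
        by (simp add: cz if_distrib[of "\<lambda>u. (cmod u)\<^sup>2"] cong: if_cong)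
      then show ?thesis using cinner_self_sums[of z] by (simp add: cinner_self sums_iff)
    qed
    have "cinner (T z) y = of_real s"
      using trunc_S[of N z y] unfolding tz s_def
      by (simp add: cz complex_norm_square mult.commute del: of_real_power)
    then have "s \<le> cmod (cinner (T z) y)" by simp
    also have "\<dots> \<le> norm (T z) * norm y" by (rule norm_cinner)
    also have "\<dots> \<le> (norm T * norm z) * norm y"
      by (intro mult_right_mono norm_blinfun) simp
    finally have "norm z * norm z \<le> norm z * (norm T * norm y)"
      using nz by (simp add: power2_eq_square algebra_simps)
    then have "norm z \<le> norm T * norm y"
      by (cases "norm z = 0") (simp_all add: mult_le_cancel_left)
    then have "(norm z)\<^sup>2 \<le> (norm T * norm y)\<^sup>2" by (intro power_mono) simp_all
    then show ?thesis using nz by (simp add: s_def)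
  qed
  have summ: "summable (\<lambda>i. (cmod (cinner (T (basis_vec i)) y))\<^sup>2)" for y
    by (rule summableI_nonneg_bounded[OF _ sq]) simp
  define S where "S y = Abs_ell2 (\<lambda>i. cinner (T (basis_vec i)) y)" for y
  have cS: "coord (S y) i = cinner (T (basis_vec i)) y" for y i
    unfolding S_def using summ[of y] by (subst Abs_ell2_inverse) simp_all
  have adj: "cinner (T x) y = cinner x (S y)" for x y
  proof -
    have "(\<lambda>N. \<Sum>i<N. cnj (coord x i) * coord (S y) i) \<longlonglongrightarrow> cinner x (S y)"
      using cinner_sums by (simp add: sums_def)
    then have 1: "(\<lambda>N. cinner (T (trunc (enat N) x)) y) \<longlonglongrightarrow> cinner x (S y)"
      by (simp add: trunc_S cS)
    have "(\<lambda>N. T (trunc (enat N) x)) \<longlonglongrightarrow> T x"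
      by (intro blinfun.tendsto tendsto_const trunc_tendsto)
    then have "(\<lambda>N. cinner y (T (trunc (enat N) x))) \<longlonglongrightarrow> cinner y (T x)"
      by (rule cinner_right_cong_tendsto)
    then have "(\<lambda>N. cnj (cinner y (T (trunc (enat N) x)))) \<longlonglongrightarrow> cnj (cinner y (T x))"
      by (rule tendsto_cnj)
    then have "(\<lambda>N. cinner (T (trunc (enat N) x)) y) \<longlonglongrightarrow> cinner (T x) y"
      by (simp add: cinner_cnj[symmetric])
    then show ?thesis using 1 LIMSEQ_unique by blast
  qed
  have "bounded_linear S"
  proof (rule bounded_linear_intro[where K = "norm T"])
    show "S (x + y) = S x + S y" for x y
      by (rule cinner_eqI) (simp add: adj[symmetric] cinner_add_right)
    show "S (r *\<^sub>R x) = r *\<^sub>R S x" for r x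
      by (rule cinner_eqI) (simp add: adj[symmetric] scaleR_scaleC cinner_scaleC_right)
    show "norm (S y) \<le> norm y * norm T" for y
    proof -
      have "(\<Sum>i. (cmod (cinner (T (basis_vec i)) y))\<^sup>2) \<le> (norm T * norm y)\<^sup>2"
        by (rule suminf_le_const[OF summ]) (rule sq)
      moreover have "(norm (S y))\<^sup>2 = (\<Sum>i. (cmod (cinner (T (basis_vec i)) y))\<^sup>2)"
        using cinner_self_sums[of "S y"] by (simp add: cS cinner_self sums_iff)
      ultimately have "(norm (S y))\<^sup>2 \<le> (norm T * norm y)\<^sup>2" by simp
      then show ?thesis by (simp add: abs_le_square_iff[symmetric] mult.commute abs_mult)
    qed
  qed
  then have "\<forall>x y. cinner (T x) y = cinner x (blinfun_apply (Blinfun S) y)"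
    by (simp add: bounded_linear_Blinfun_apply adj)
  moreover have "S1 = S2"
    if "\<forall>x y. cinner (T x) y = cinner x (blinfun_apply S1 y)"
      "\<forall>x y. cinner (T x) y = cinner x (blinfun_apply S2 y)" for S1 S2
    by (rule blinfun_eqI, rule cinner_eqI) (use that in metis)
  ultimately show ?thesis by blast
qed

lemma cinner_adj:
  assumes "clinear_op T"
  shows "cinner (T x) y = cinner x (adj T y)"
  using theI'[OF adj_ex1[OF assms]] unfolding adj_def by blast

definition isometry_op :: "enat \<Rightarrow> enat \<Rightarrow> op \<Rightarrow> bool" where
  "isometry_op n m V \<longleftrightarrow> V \<in> bop n m \<and> adj V o\<^sub>L V = idop n"

definition unitary_group :: "enat \<Rightarrow> op monoid" where
  "unitary_group n = \<lparr>carrier = {U \<in> bop n n. adj U o\<^sub>L U = idop n \<and> U o\<^sub>L adj U = idop n},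
     mult = (o\<^sub>L), one = idop n\<rparr>"

text \<open>Unconditional convergence of a series of operators in the weak operator topology.\<close>

definition wot_has_sum :: "('j \<Rightarrow> op) \<Rightarrow> op \<Rightarrow> 'j set \<Rightarrow> bool" where
  "wot_has_sum F T J \<longleftrightarrow> (\<forall>x y. ((\<lambda>j. cinner x (F j y)) has_sum cinner x (T y)) J)"

text \<open>Positivity of a matrix \<open>(X i j)\<close>, \<open>i, j < m\<close>, of operators, acting on the \<open>m\<close>-fold direct sum.
  For entries in \<open>bop n n\<close> the vectors may equivalently be restricted to $\ell^2(n)$.\<close>

definition pos_op_matrix :: "nat \<Rightarrow> (nat \<Rightarrow> nat \<Rightarrow> op) \<Rightarrow> bool" where
  "pos_op_matrix m X \<longleftrightarrow>
     (\<forall>\<xi> :: nat \<Rightarrow> ell2. (\<Sum>i<m. \<Sum>j<m. cinner (\<xi> i) (X i j (\<xi> j))) \<in> \<real>\<^sub>\<ge>\<^sub>0)"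


section \<open>Free products of groups\<close>

text \<open>The free product is the free monoid over the disjoint union of the carriers, modulo the
  smallest congruence that identifies the two units with the empty word and multiplies out
  adjacent letters from the same factor.\<close>

inductive fp_rel :: "('a, 'c) monoid_scheme \<Rightarrow> ('b, 'd) monoid_scheme
    \<Rightarrow> ('a + 'b) list \<Rightarrow> ('a + 'b) list \<Rightarrow> bool" for G H where
  one_left: "fp_rel G H (xs @ Inl \<one>\<^bsub>G\<^esub> # ys) (xs @ ys)"
| one_right: "fp_rel G H (xs @ Inr \<one>\<^bsub>H\<^esub> # ys) (xs @ ys)"
| mult_left: "\<lbrakk>a \<in> carrier G; b \<in> carrier G\<rbrakk> \<Longrightarrow>
    fp_rel G H (xs @ Inl a # Inl b # ys) (xs @ Inl (a \<otimes>\<^bsub>G\<^esub> b) # ys)"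
| mult_right: "\<lbrakk>a \<in> carrier H; b \<in> carrier H\<rbrakk> \<Longrightarrow>
    fp_rel G H (xs @ Inr a # Inr b # ys) (xs @ Inr (a \<otimes>\<^bsub>H\<^esub> b) # ys)"
| refl: "fp_rel G H xs xs"
| sym: "fp_rel G H xs ys \<Longrightarrow> fp_rel G H ys xs"
| trans: "\<lbrakk>fp_rel G H xs ys; fp_rel G H ys zs\<rbrakk> \<Longrightarrow> fp_rel G H xs zs"

definition fp_class :: "('a, 'c) monoid_scheme \<Rightarrow> ('b, 'd) monoid_scheme
    \<Rightarrow> ('a + 'b) list \<Rightarrow> ('a + 'b) list set" where
  "fp_class G H xs = {ys \<in> lists (carrier G <+> carrier H). fp_rel G H xs ys}"

definition free_product :: "('a, 'c) monoid_scheme \<Rightarrow> ('b, 'd) monoid_scheme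
    \<Rightarrow> ('a + 'b) list set monoid" where
  "free_product G H = \<lparr>carrier = fp_class G H ` lists (carrier G <+> carrier H),
     mult = (\<lambda>A B. \<Union>xs\<in>A. \<Union>ys\<in>B. fp_class G H (xs @ ys)),
     one = fp_class G H []\<rparr>"

lemma fp_rel_append_left: "fp_rel G H xs ys \<Longrightarrow> fp_rel G H (zs @ xs) (zs @ ys)"
proof (induction rule: fp_rel.induct)
  case (one_left xs ys)
  then show ?case using fp_rel.one_left[of G H "zs @ xs" ys] by simp
next
  case (one_right xs ys)
  then show ?case using fp_rel.one_right[of G H "zs @ xs" ys] by simp
next
  case (mult_left a b xs ys)
  then show ?case using fp_rel.mult_left[of a G b H "zs @ xs" ys] by simp
next
  case (mult_right a b xs ys)
  then show ?case using fp_rel.mult_right[of a H b G "zs @ xs" ys] by simp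
next
  case (trans xs ys zs)
  show ?case by (rule fp_rel.trans) (rule trans.IH)+
qed (rule fp_rel.refl, erule fp_rel.sym)

lemma fp_rel_append_right: "fp_rel G H xs ys \<Longrightarrow> fp_rel G H (xs @ zs) (ys @ zs)"
proof (induction rule: fp_rel.induct)
  case (one_left xs ys)
  then show ?case using fp_rel.one_left[of G H xs "ys @ zs"] by simp
next
  case (one_right xs ys)
  then show ?case using fp_rel.one_right[of G H xs "ys @ zs"] by simp
next
  case (mult_left a b xs ys)
  then show ?case using fp_rel.mult_left[of a G b H xs "ys @ zs"] by simp
next
  case (mult_right a b xs ys)
  then show ?case using fp_rel.mult_right[of a H b G xs "ys @ zs"] by simp
next
  case (trans xs ys zs)
  show ?case by (rule fp_rel.trans) (rule trans.IH)+
qed (rule fp_rel.refl, erule fp_rel.sym)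

lemma fp_class_eqI: "fp_rel G H xs ys \<Longrightarrow> fp_class G H xs = fp_class G H ys"
  unfolding fp_class_def by (intro Collect_cong conj_cong HOL.refl iffI)
    (erule fp_rel.trans[OF fp_rel.sym], assumption, erule fp_rel.trans, assumption)

lemma fp_class_mult:
  assumes "xs \<in> lists (carrier G <+> carrier H)" "ys \<in> lists (carrier G <+> carrier H)"
  shows "fp_class G H xs \<otimes>\<^bsub>free_product G H\<^esub> fp_class G H ys = fp_class G H (xs @ ys)"
proof -
  have "fp_class G H (xs' @ ys') = fp_class G H (xs @ ys)"
    if "xs' \<in> fp_class G H xs" "ys' \<in> fp_class G H ys" for xs' ys'
  proof (rule fp_class_eqI[symmetric])
    have "fp_rel G H xs xs'" "fp_rel G H ys ys'" using that by (auto simp: fp_class_def)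
    then show "fp_rel G H (xs @ ys) (xs' @ ys')"
      by (meson fp_rel.trans fp_rel_append_left fp_rel_append_right)
  qed
  moreover have "xs \<in> fp_class G H xs" "ys \<in> fp_class G H ys"
    using assms by (auto simp: fp_class_def fp_rel.refl)
  ultimately have "(\<Union>xs'\<in>fp_class G H xs. \<Union>ys'\<in>fp_class G H ys. fp_class G H (xs' @ ys'))
      = fp_class G H (xs @ ys)"
    by blast
  then show ?thesis by (simp add: free_product_def)
qed

lemma group_free_product:
  assumes "group G" "group H"
  shows "group (free_product G H)"
proof -
  interpret G: group G by fact
  interpret H: group H by fact
  let ?W = "lists (carrier G <+> carrier H)"
  have inv: "\<exists>ys\<in>?W. fp_rel G H (ys @ xs) []" if "xs \<in> ?W" for xs
    using that
  proof (induction xs)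
    case Nil
    then show ?case using fp_rel.refl[of G H "[]"] by force
  next
    case (Cons z xs)
    then obtain ys where ys: "ys \<in> ?W" "fp_rel G H (ys @ xs) []" by auto
    from Cons obtain z' where z': "z' \<in> carrier G <+> carrier H" "fp_rel G H [z', z] []"
    proof (cases z)
      case (Inl a)
      then have a: "a \<in> carrier G" using Cons by auto
      then have "fp_rel G H [Inl (inv\<^bsub>G\<^esub> a), z] []"
        using fp_rel.mult_left[of "inv\<^bsub>G\<^esub> a" G a H "[]" "[]"] fp_rel.one_left[of G H "[]" "[]"] Inl
        by (auto intro: fp_rel.trans)
      then show ?thesis using that[of "Inl (inv\<^bsub>G\<^esub> a)"] a by auto
    next
      case (Inr a)
      then have a: "a \<in> carrier H" using Cons by auto
      then have "fp_rel G H [Inr (inv\<^bsub>H\<^esub> a), z] []"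
        using fp_rel.mult_right[of "inv\<^bsub>H\<^esub> a" H a G "[]" "[]"] fp_rel.one_right[of G H "[]" "[]"] Inr
        by (auto intro: fp_rel.trans)
      then show ?thesis using that[of "Inr (inv\<^bsub>H\<^esub> a)"] a by auto
    qed
    have "fp_rel G H (ys @ [z', z] @ xs) (ys @ xs)"
      using fp_rel_append_left[OF fp_rel_append_right[OF z'(2), of xs], of ys] by simp
    then have "fp_rel G H ((ys @ [z']) @ z # xs) []" using ys(2) by (auto intro: fp_rel.trans)
    moreover have "ys @ [z'] \<in> ?W" using ys z' by auto
    ultimately show ?case by blast
  qed
  have c: "carrier (free_product G H) = fp_class G H ` ?W"
    and o: "\<one>\<^bsub>free_product G H\<^esub> = fp_class G H []"
    by (simp_all add: free_product_def)
  show ?thesis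
  proof (rule groupI)
    fix A assume "A \<in> carrier (free_product G H)"
    then obtain xs where xs: "xs \<in> ?W" "A = fp_class G H xs" by (auto simp: c)
    obtain ys where ys: "ys \<in> ?W" "fp_rel G H (ys @ xs) []" using inv xs by blast
    show "\<exists>B\<in>carrier (free_product G H). B \<otimes>\<^bsub>free_product G H\<^esub> A = \<one>\<^bsub>free_product G H\<^esub>"
      unfolding c o by (rule rev_bexI[OF imageI[OF ys(1)]])
        (simp only: xs(2) fp_class_mult[OF ys(1) xs(1)] fp_class_eqI[OF ys(2)])
  next
    fix A B assume "A \<in> carrier (free_product G H)" "B \<in> carrier (free_product G H)"
    then obtain xs ys where "xs \<in> ?W" "A = fp_class G H xs" "ys \<in> ?W" "B = fp_class G H ys"
      by (auto simp only: c)
    moreover from this have "xs @ ys \<in> ?W" by simp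
    ultimately show "A \<otimes>\<^bsub>free_product G H\<^esub> B \<in> carrier (free_product G H)"
      by (simp only: c fp_class_mult imageI)
  next
    show "\<one>\<^bsub>free_product G H\<^esub> \<in> carrier (free_product G H)"
      by (simp only: c o imageI lists.Nil)
  next
    fix A B C assume "A \<in> carrier (free_product G H)" "B \<in> carrier (free_product G H)"
      "C \<in> carrier (free_product G H)"
    then obtain xs ys zs where *: "xs \<in> ?W" "A = fp_class G H xs" "ys \<in> ?W" "B = fp_class G H ys"
      "zs \<in> ?W" "C = fp_class G H zs"
      by (auto simp only: c)
    from * have "xs @ ys \<in> ?W" "ys @ zs \<in> ?W" by simp_all
    with * show "A \<otimes>\<^bsub>free_product G H\<^esub> B \<otimes>\<^bsub>free_product G H\<^esub> C
        = A \<otimes>\<^bsub>free_product G H\<^esub> (B \<otimes>\<^bsub>free_product G H\<^esub> C)"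
      by (simp only: fp_class_mult append_assoc)
  next
    fix A assume "A \<in> carrier (free_product G H)"
    then obtain xs where *: "xs \<in> ?W" "A = fp_class G H xs" by (auto simp only: c)
    then show "\<one>\<^bsub>free_product G H\<^esub> \<otimes>\<^bsub>free_product G H\<^esub> A = A"
      by (simp only: o fp_class_mult[OF lists.Nil] append_Nil)
  qed
qed


section \<open>Full group C*-algebras\<close>

text \<open>Unitary representations on the spaces $\ell^2(n)$, $1 \le n \le \aleph_0$. For a countable
  group \<open>G\<close> every cyclic unitary representation is unitarily equivalent to one of these, so
  their direct sum is a universal representation.\<close>

definition unitary_reps :: "('g, 'm) monoid_scheme \<Rightarrow> (enat \<times> ('g \<Rightarrow> op)) set" where
  "unitary_reps G = {(n, \<pi>). n \<noteq> 0 \<and> \<pi> \<in> hom G (unitary_group n)}"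

text \<open>An operator on the direct sum of all these representations which is block diagonal is the
  family of its blocks. The C*-operations are computed blockwise, and the norm of the direct sum
  is the supremum of the norms of the blocks.\<close>

type_synonym 'g opfam = "enat \<times> ('g \<Rightarrow> op) \<Rightarrow> op"

definition scale_fam :: "complex \<Rightarrow> ('i \<Rightarrow> op) \<Rightarrow> 'i \<Rightarrow> op" where
  "scale_fam c a = (\<lambda>\<rho>. scale_op c (a \<rho>))"

definition star :: "('i \<Rightarrow> op) \<Rightarrow> 'i \<Rightarrow> op" where
  "star a = (\<lambda>\<rho>. adj (a \<rho>))"

interpretation fam: vector_space "scale_fam :: complex \<Rightarrow> ('i \<Rightarrow> op) \<Rightarrow> 'i \<Rightarrow> op"
proof
  fix a b :: complex and x y :: "'i \<Rightarrow> op"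
  show "scale_fam a (x + y) = scale_fam a x + scale_fam a y"
    by (intro ext blinfun_eqI) (simp add: scale_fam_def scale_op_apply blinfun.add_left scaleC_simps)
  show "scale_fam (a + b) x = scale_fam a x + scale_fam b x"
    by (intro ext blinfun_eqI) (simp add: scale_fam_def scale_op_apply blinfun.add_left scaleC_simps)
  show "scale_fam a (scale_fam b x) = scale_fam (a * b) x"
    by (intro ext blinfun_eqI) (simp add: scale_fam_def scale_op_apply scaleC_simps)
  show "scale_fam 1 x = x"
    by (intro ext blinfun_eqI) (simp add: scale_fam_def scale_op_apply scaleC_simps)
qed

definition cspan :: "('i \<Rightarrow> op) set \<Rightarrow> ('i \<Rightarrow> op) set" where
  "cspan = module.span scale_fam"

definition group_unitary :: "('g, 'm) monoid_scheme \<Rightarrow> 'g \<Rightarrow> 'g opfam" where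
  "group_unitary G g = (\<lambda>\<rho>. if \<rho> \<in> unitary_reps G then snd \<rho> g else 0)"

text \<open>The full group C*-algebra of a countable group: the norm closure of the linear span of the
  group unitaries in the universal representation.\<close>

definition full_cstar :: "('g, 'm) monoid_scheme \<Rightarrow> 'g opfam monoid" where
  "full_cstar G = \<lparr>
     carrier = {a. \<forall>\<epsilon>>0. \<exists>b\<in>cspan (group_unitary G ` carrier G). \<forall>\<rho>. norm (a \<rho> - b \<rho>) \<le> \<epsilon>},
     mult = (\<lambda>a b \<rho>. a \<rho> o\<^sub>L b \<rho>),
     one = group_unitary G \<one>\<^bsub>G\<^esub>\<rparr>"

text \<open>\<open>X\<close> is positive in the C*-algebra of \<open>m\<close> by \<open>m\<close> matrices over \<open>A\<close>, i.e. of the form \<open>B\<^sup>*B\<close>.\<close>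

definition pos_matrix :: "('i \<Rightarrow> op) monoid \<Rightarrow> nat \<Rightarrow> (nat \<Rightarrow> nat \<Rightarrow> 'i \<Rightarrow> op) \<Rightarrow> bool" where
  "pos_matrix A m X \<longleftrightarrow> (\<exists>B. (\<forall>i<m. \<forall>j<m. B i j \<in> carrier A) \<and>
     (\<forall>i<m. \<forall>j<m. X i j = (\<Sum>l<m. star (B l i) \<otimes>\<^bsub>A\<^esub> B l j)))"

text \<open>Unital completely positive maps from an operator system \<open>R\<close> in the C*-algebra \<open>A\<close> to
  $\mathcal B(\ell^2(n))$. They are made to vanish outside \<open>R\<close>, so that equality of maps on \<open>R\<close> is
  equality of HOL functions.\<close>

definition ucp :: "('i \<Rightarrow> op) monoid \<Rightarrow> ('i \<Rightarrow> op) set \<Rightarrow> enat \<Rightarrow> (('i \<Rightarrow> op) \<Rightarrow> op) \<Rightarrow> bool" where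
  "ucp A R n \<phi> \<longleftrightarrow>
     (\<forall>a. a \<notin> R \<longrightarrow> \<phi> a = 0) \<and>
     (\<forall>a\<in>R. \<phi> a \<in> bop n n) \<and>
     (\<forall>a\<in>R. \<forall>b\<in>R. \<phi> (a + b) = \<phi> a + \<phi> b) \<and>
     (\<forall>c. \<forall>a\<in>R. \<phi> (scale_fam c a) = scale_op c (\<phi> a)) \<and>
     \<phi> \<one>\<^bsub>A\<^esub> = idop n \<and>
     (\<forall>m X. (\<forall>i<m. \<forall>j<m. X i j \<in> R) \<and> pos_matrix A m X
        \<longrightarrow> pos_op_matrix m (\<lambda>i j. \<phi> (X i j)))"


section \<open>Noncommutative extreme points\<close>

text \<open>A graded set assigns to a level \<open>n\<close> a set of families \<open>('i \<Rightarrow> op)\<close> of operators on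
  $\ell^2(n)$. This covers both \<open>d\<close>-tuples of operators and operator-valued maps, with
  compressions and sums formed index by index.\<close>

type_synonym 'i graded = "enat \<Rightarrow> ('i \<Rightarrow> op) set"

definition compress :: "op \<Rightarrow> ('i \<Rightarrow> op) \<Rightarrow> op \<Rightarrow> 'i \<Rightarrow> op" where
  "compress V x U = (\<lambda>i. adj V o\<^sub>L x i o\<^sub>L U)"

text \<open>A family of nonzero operators \<open>\<gamma>\<^sub>j\<close> on the separable space $\ell^2(n)$ with
  \<open>\<Sum>\<^sub>j \<gamma>\<^sub>j\<^sup>*\<gamma>\<^sub>j = 1\<close> is countable, hence index sets of natural numbers suffice.\<close>

definition nc_pure :: "'i graded \<Rightarrow> enat \<Rightarrow> ('i \<Rightarrow> op) \<Rightarrow> bool" where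
  "nc_pure K n x \<longleftrightarrow> x \<in> K n \<and>
     (\<forall>(J :: nat set) N y \<gamma>.
        (\<forall>j\<in>J. N j \<noteq> 0 \<and> y j \<in> K (N j) \<and> \<gamma> j \<in> bop n (N j) \<and> \<gamma> j \<noteq> 0) \<and>
        (\<exists>C. \<forall>j\<in>J. norm (\<gamma> j) \<le> C) \<and>
        wot_has_sum (\<lambda>j. adj (\<gamma> j) o\<^sub>L \<gamma> j) (idop n) J \<and>
        (\<forall>i. wot_has_sum (\<lambda>j. compress (\<gamma> j) (y j) (\<gamma> j) i) (x i) J)
        \<longrightarrow> (\<forall>j\<in>J. \<exists>c \<nu>. isometry_op n (N j) \<nu> \<and> \<gamma> j = scale_op c \<nu> \<and>
               compress \<nu> (y j) \<nu> = x))"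

text \<open>The decomposition of the space at level \<open>N\<close> into $\ell^2(n) \oplus \ell^2(m)$ is given by two
  isometries \<open>V\<close>, \<open>U\<close> with complementary ranges; this also makes sense for \<open>n = \<infinity>\<close>.
  The entries of the block matrix \<open>y\<close> are then \<open>x = V\<^sup>*yV\<close>, \<open>z\<^sub>1\<^sub>2 = V\<^sup>*yU\<close>, \<open>z\<^sub>2\<^sub>1 = U\<^sup>*yV\<close>, \<open>z\<^sub>2\<^sub>2 = U\<^sup>*yU\<close>.\<close>

definition nc_maximal :: "'i graded \<Rightarrow> enat \<Rightarrow> ('i \<Rightarrow> op) \<Rightarrow> bool" where
  "nc_maximal K n x \<longleftrightarrow> x \<in> K n \<and>
     (\<forall>m N V U y. m \<noteq> 0 \<and> isometry_op n N V \<and> isometry_op m N U \<and>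
        (V o\<^sub>L adj V) + (U o\<^sub>L adj U) = idop N \<and> y \<in> K N \<and> compress V y V = x
        \<longrightarrow> compress V y U = 0 \<and> compress U y V = 0 \<and> compress U y U \<in> K m)"

definition nc_extreme :: "'i graded \<Rightarrow> enat \<Rightarrow> ('i \<Rightarrow> op) \<Rightarrow> bool" where
  "nc_extreme K n x \<longleftrightarrow> nc_pure K n x \<and> nc_maximal K n x"


section \<open>The noncommutative prism\<close>

definition Zk_Z2 :: "nat \<Rightarrow> (int + int) list set monoid" where
  "Zk_Z2 k = free_product (integer_mod_group k) (integer_mod_group 2)"

type_synonym prism_elt = "(int + int) list set opfam"

definition prism_alg :: "nat \<Rightarrow> prism_elt monoid" where
  "prism_alg k = full_cstar (Zk_Z2 k)"

definition gen_w :: "nat \<Rightarrow> prism_elt" where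
  "gen_w k = group_unitary (Zk_Z2 k)
     (fp_class (integer_mod_group k) (integer_mod_group 2) [Inl 1])"

definition gen_v :: "nat \<Rightarrow> prism_elt" where
  "gen_v k = group_unitary (Zk_Z2 k)
     (fp_class (integer_mod_group k) (integer_mod_group 2) [Inr 1])"

definition NCP :: "nat \<Rightarrow> prism_elt set" where
  "NCP k = cspan (insert (gen_v k) {gen_w k [^]\<^bsub>prism_alg k\<^esub> i | i :: nat. i < k})"

definition nc_state_space :: "('i \<Rightarrow> op) monoid \<Rightarrow> ('i \<Rightarrow> op) set \<Rightarrow> ('i \<Rightarrow> op) graded" where
  "nc_state_space A R n = (if n = 0 then {} else {\<phi>. ucp A R n \<phi>})"

text \<open>A pair of operators is the family indexed by \<^typ>\<open>bool\<close> with first entry at \<^const>\<open>True\<close>.\<close>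

definition nc_prism :: "nat \<Rightarrow> bool graded" where
  "nc_prism k n = (if n = 0 then {} else
     {case_bool (\<phi> (gen_w k)) (\<phi> (gen_v k)) | \<phi>.
        ucp (prism_alg k) (cspan {\<one>\<^bsub>prism_alg k\<^esub>, gen_w k, star (gen_w k), gen_v k}) n \<phi>})"

end

theory Submission
  imports Defs
begin

text \<open>The idea is that an irreducible unitary representation of the group yields a noncommutative extreme
  point, and that \<open>\<int>\<^sub>k * \<int>\<^sub>2\<close> has irreducible representations of every finite dimension as soon
  as \<open>k \<ge> 3\<close>.

  Extremality. Let \<open>x\<close> be a point whose coordinates are unitary. Unital completely positive maps are
  contractive on unitaries (\<open>ucp_contraction\<close>), so the coordinates of all other points are contractions.
  A contraction that compresses to a unitary must leave the corresponding subspace invariant, and the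
  same holds for its adjoint (\<open>contraction_intertwines_unitary\<close>). Hence every operator \<open>\<gamma>\<^sub>j\<close> in a
  decomposition \<open>x = \<Sum>\<gamma>\<^sub>j\<^sup>* x\<^sub>j \<gamma>\<^sub>j\<close> intertwines \<open>x\<close> with \<open>x\<^sub>j\<close>. For a
  dilation of \<open>x\<close> this kills the off-diagonal corners, which is maximality. In general
  \<open>\<gamma>\<^sub>j\<^sup>*\<gamma>\<^sub>j\<close> commutes with all coordinates of \<open>x\<close>; if their commutant is trivial, then
  \<open>\<gamma>\<^sub>j\<close> is a multiple of an isometry, which is purity. The locale \<open>unitary_generators\<close> collects
  what is used, and it applies to pairs of operators as well as to maps on an operator system.

  Irreducible representations. On \<open>\<complex>\<^sup>n\<close> with basis \<open>e\<^sub>0, e\<^sub>1, \<dots>\<close> let \<open>v\<close> exchange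
  \<open>e\<^sub>0\<close> and \<open>e\<^sub>1\<close>, \<open>e\<^sub>2\<close> and \<open>e\<^sub>3\<close>, and so on. Let \<open>w\<close> multiply \<open>e\<^sub>0\<close> by \<open>\<omega>\<^sup>2\<close>
  for a primitive \<open>k\<close>-th root of unity \<open>\<omega>\<close>, and let it act on the spans of \<open>e\<^sub>1, e\<^sub>2\<close>, of
  \<open>e\<^sub>3, e\<^sub>4\<close>, and so on by a unitary block that is not diagonal and has the eigenvalues \<open>1\<close> and \<open>\<omega>\<close>.
  A basis vector left over at the end is fixed. Then \<open>e\<^sub>0\<close> spans an eigenspace of \<open>w\<close>,
  so it is an eigenvector of everything in the commutant; and it is cyclic, because \<open>v\<close> and \<open>w\<close> in turn lead from each basis vector to the next. Hence the
  commutant is trivial (\<open>commutant_trivial\<close>).\<close>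

section \<open>Operators on square-summable sequences\<close>

lemma ell2_eqI: "(\<And>i. coord x i = coord y i) \<Longrightarrow> x = y"
  by (simp add: coord_inject[symmetric] fun_eq_iff)

lemmas coord_simps = zero_ell2.rep_eq plus_ell2.rep_eq minus_ell2.rep_eq scaleC.rep_eq
  trunc.rep_eq basis_vec.rep_eq

lemma cinner_diff_right: "cinner x (y - z) = cinner x y - cinner x z"
  using cinner_add_right[of x "y - z" z] by simp

lemma cinner_diff_left: "cinner (x - y) z = cinner x z - cinner y z"
  using cinner_add_left[of "x - y" y z] by simp

lemma cinner_zero [simp]: "cinner x 0 = 0" "cinner 0 x = 0"
  using cinner_diff_right[of x 0 0] cinner_diff_left[of 0 0 x] by simp_all

lemma cinner_basis_right: "cinner x (basis_vec i) = cnj (coord x i)"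
  by (metis cinner_basis_left cinner_cnj)

lemma cinner_trunc: "cinner (trunc n x) y = cinner x (trunc n y)"
  unfolding cinner_def by (intro arg_cong[where f = suminf]) (auto simp: trunc.rep_eq)

lemma trunc_trunc [simp]: "trunc n (trunc n x) = trunc n x"
  by (intro ell2_eqI) (simp add: trunc.rep_eq)

lemma trunc_scaleC: "trunc n (scaleC c x) = scaleC c (trunc n x)"
  by (intro ell2_eqI) (simp add: coord_simps)

lemma trunc_add: "trunc n (x + y) = trunc n x + trunc n y"
  by (intro ell2_eqI) (simp add: coord_simps)

lemma trunc_zero [simp]: "trunc n 0 = 0"
  by (intro ell2_eqI) (simp add: coord_simps)

lemma scaleC_zero [simp]: "scaleC 0 x = 0" "scaleC c 0 = 0"
  by (auto intro!: ell2_eqI simp: coord_simps)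

text \<open>An operator that satisfies the adjoint identity is determined by it, so the definite description
  picks it out.\<close>

lemma adjI:
  assumes "\<And>x y. cinner (blinfun_apply T x) y = cinner x (blinfun_apply S y)"
  shows "adj T = S"
  unfolding adj_def
proof (rule the_equality)
  show "\<forall>x y. cinner (T x) y = cinner x (S y)" using assms by blast
  show "S' = S" if "\<forall>x y. cinner (T x) y = cinner x (blinfun_apply S' y)" for S'
    by (rule blinfun_eqI, rule cinner_eqI) (use that assms in metis)
qed

lemma cinner_adj_left: "clinear_op T \<Longrightarrow> cinner (adj T x) y = cinner x (T y)"
  by (metis cinner_adj cinner_cnj)

lemma clinear_adj:
  assumes "clinear_op T"
  shows "clinear_op (adj T)"
  unfolding clinear_op_def
  by (intro allI cinner_eqI)
    (simp add: cinner_adj[OF assms, symmetric] cinner_scaleC_right)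

lemma clinear_comp: "clinear_op S \<Longrightarrow> clinear_op T \<Longrightarrow> clinear_op (S o\<^sub>L T)"
  by (simp add: clinear_op_def)

lemma clinear_idop [simp]: "clinear_op (idop n)"
  by (simp add: clinear_op_def idop.rep_eq trunc_scaleC)

lemma adj_adj: "clinear_op T \<Longrightarrow> adj (adj T) = T"
  by (rule adjI) (rule cinner_adj_left)

lemma op_assoc: "(R o\<^sub>L S) o\<^sub>L T = R o\<^sub>L (S o\<^sub>L T)" for R S T :: op
  by (rule blinfun_eqI) simp

lemma adj_comp: "clinear_op S \<Longrightarrow> clinear_op T \<Longrightarrow> adj (S o\<^sub>L T) = adj T o\<^sub>L adj S"
  by (rule adjI) (simp add: cinner_adj)

lemma adj_idop [simp]: "adj (idop n) = idop n"
  by (rule adjI) (simp add: idop.rep_eq cinner_trunc)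

lemma adj_zero [simp]: "adj 0 = 0"
  by (rule adjI) simp

lemma adj_scale_op: "clinear_op T \<Longrightarrow> adj (scale_op c T) = scale_op (cnj c) (adj T)"
  by (rule adjI) (simp add: scale_op_apply cinner_scaleC_left cinner_scaleC_right cinner_adj)

lemma clinear_scale_op: "clinear_op T \<Longrightarrow> clinear_op (scale_op c T)"
  by (simp add: clinear_op_def scale_op_apply scaleC_simps mult.commute)

text \<open>Besides the algebraic form, membership in \<open>bop\<close> is used pointwise: truncating the argument or the
  value changes nothing.\<close>

lemma bopD:
  assumes "T \<in> bop n m"
  shows "clinear_op T" "T o\<^sub>L idop n = T" "idop m o\<^sub>L T = T"
    "T (trunc n x) = T x" "trunc m (T x) = T x"
proof -
  show *: "clinear_op T" "T o\<^sub>L idop n = T" "idop m o\<^sub>L T = T"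
    using assms by (auto simp: bop_def)
  show "T (trunc n x) = T x" "trunc m (T x) = T x"
    using arg_cong[OF *(2), of "\<lambda>f. blinfun_apply f x"]
      arg_cong[OF *(3), of "\<lambda>f. blinfun_apply f x"] by (simp_all add: idop.rep_eq)
qed

lemma bopI:
  assumes "clinear_op T" "\<And>x. T (trunc n x) = T x" "\<And>x. trunc m (T x) = T x"
  shows "T \<in> bop n m"
  using assms by (auto simp: bop_def idop.rep_eq intro!: blinfun_eqI)

lemma bop_adj:
  assumes "T \<in> bop n m"
  shows "adj T \<in> bop m n"
  using arg_cong[OF bopD(2)[OF assms], of adj] arg_cong[OF bopD(3)[OF assms], of adj]
  by (simp add: bop_def adj_comp clinear_adj bopD(1)[OF assms])

lemma bop_comp:
  assumes "S \<in> bop m l" "T \<in> bop n m"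
  shows "S o\<^sub>L T \<in> bop n l"
  by (rule bopI) (use assms in \<open>simp_all add: bopD clinear_comp\<close>)

lemma bop_idop: "idop n \<in> bop n n"
  by (rule bopI) (simp_all add: idop.rep_eq)

lemma bop_zero: "0 \<in> bop n m"
  by (rule bopI) (simp_all add: clinear_op_def)

lemma bop_add: "S \<in> bop n m \<Longrightarrow> T \<in> bop n m \<Longrightarrow> S + T \<in> bop n m"
  by (rule bopI)
    (simp_all add: bopD(1)[unfolded clinear_op_def] bopD(4,5) clinear_op_def blinfun.add_left
      scaleC_simps trunc_add)

lemma bop_scale_op: "T \<in> bop n m \<Longrightarrow> scale_op c T \<in> bop n m"
  by (rule bopI) (simp_all add: bopD clinear_scale_op scale_op_apply trunc_scaleC)

lemma norm_sq_adj_comp: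
  assumes "clinear_op T"
  shows "cinner x ((adj T o\<^sub>L T) x) = of_real ((norm (T x))\<^sup>2)"
  by (simp add: cinner_adj[OF assms, symmetric] cinner_self)

lemma norm_sq_diff: "(norm (x - y))\<^sup>2 = (norm x)\<^sup>2 - 2 * Re (cinner y x) + (norm y)\<^sup>2"
  for x y :: ell2
proof -
  have "Re (cinner x y) = Re (cinner y x)"
    by (subst cinner_cnj) simp
  then show ?thesis
    by (simp add: power2_norm_eq_inner inner_ell2_def cinner_diff_left cinner_diff_right)
qed


section \<open>Contractive dilations of unitaries split\<close>

definition contraction :: "op \<Rightarrow> bool" where
  "contraction T \<longleftrightarrow> (\<forall>x. norm (T x) \<le> norm x)"

lemma contraction_adj:
  assumes "clinear_op T" "contraction T"
  shows "contraction (adj T)"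
  unfolding contraction_def
proof
  fix x
  have "(norm (adj T x))\<^sup>2 = cmod (cinner (adj T x) (adj T x))"
    by (simp add: cinner_self norm_power)
  also have "\<dots> = cmod (cinner x (T (adj T x)))"
    by (simp add: cinner_adj_left[OF assms(1)])
  also have "\<dots> \<le> norm x * norm (T (adj T x))" by (rule norm_cinner)
  also have "\<dots> \<le> norm x * norm (adj T x)"
    using assms(2) by (intro mult_left_mono) (auto simp: contraction_def)
  finally have "norm (adj T x) * norm (adj T x) \<le> norm x * norm (adj T x)"
    by (simp add: power2_eq_square)
  then show "norm (adj T x) \<le> norm x"
    by (cases "norm (adj T x) = 0") (auto simp: mult_le_cancel_right)
qed

definition unitary_op :: "enat \<Rightarrow> op \<Rightarrow> bool" where
  "unitary_op n U \<longleftrightarrow> U \<in> bop n n \<and> adj U o\<^sub>L U = idop n \<and> U o\<^sub>L adj U = idop n"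

lemma unitary_op_adj: "unitary_op n U \<Longrightarrow> unitary_op n (adj U)"
  by (auto simp: unitary_op_def bop_adj adj_adj bopD(1))

lemma norm_unitary_op:
  assumes "unitary_op n U"
  shows "norm (U x) = norm (trunc n x)"
proof -
  have U: "clinear_op U" "adj U o\<^sub>L U = idop n"
    using assms by (auto simp: unitary_op_def bopD(1))
  have "complex_of_real ((norm (U x))\<^sup>2) = cinner x (trunc n x)"
    unfolding norm_sq_adj_comp[OF U(1), symmetric] U(2) by (simp add: idop.rep_eq)
  also have "\<dots> = cinner (trunc n x) (trunc n x)"
    by (simp add: cinner_trunc)
  also have "\<dots> = of_real ((norm (trunc n x))\<^sup>2)" by (rule cinner_self)
  finally have "(norm (U x))\<^sup>2 = (norm (trunc n x))\<^sup>2"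
    using of_real_eq_iff by blast
  then show ?thesis by simp
qed

lemma wot_has_sum_adj:
  assumes "wot_has_sum F T J" "\<And>j. j \<in> J \<Longrightarrow> clinear_op (F j)" "clinear_op T"
  shows "wot_has_sum (\<lambda>j. adj (F j)) (adj T) J"
  unfolding wot_has_sum_def
proof (intro allI)
  fix x y
  have "((\<lambda>j. cnj (cinner y (F j x))) has_sum cnj (cinner y (T x))) J"
    using assms(1) by (auto simp: wot_has_sum_def)
  then have "((\<lambda>j. cinner (F j x) y) has_sum cinner (T x) y) J"
    by (simp add: cinner_cnj[symmetric])
  also have "?this \<longleftrightarrow> ((\<lambda>j. cinner x (adj (F j) y)) has_sum cinner x (adj T y)) J"
    unfolding cinner_adj[OF assms(3)] by (intro has_sum_cong) (simp add: assms(2) cinner_adj)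
  finally show "((\<lambda>j. cinner x (adj (F j) y)) has_sum cinner x (adj T y)) J" .
qed

text \<open>The engine of the whole argument. Think of the \<open>\<gamma> j\<close> as the rows of an isometry into the
  direct sum of the target spaces, so that \<open>U\<close> is the compression of the contraction
  \<open>\<Oplus>y j\<close>. For a vector \<open>x\<close> of $\ell^2(n)$ the image under the contraction has norm at most
  \<open>\<parallel>x\<parallel>\<close>, while its projection to the range of the isometry already has norm
  \<open>\<parallel>U x\<parallel> = \<parallel>x\<parallel>\<close>. Hence nothing can leave the range. Numerically: the squared
  distances \<open>\<parallel>y j (\<gamma> j x) - \<gamma> j (U x)\<parallel>\<^sup>2\<close> are dominated by terms that sum up to
  \<open>\<parallel>x\<parallel>\<^sup>2 - 2 \<parallel>U x\<parallel>\<^sup>2 + \<parallel>U x\<parallel>\<^sup>2 = 0\<close>.\<close>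

lemma contraction_intertwines_unitary:
  assumes U: "unitary_op n U"
    and y: "\<And>j. j \<in> J \<Longrightarrow> contraction (y j)"
    and \<gamma>: "\<And>j. j \<in> J \<Longrightarrow> \<gamma> j \<in> bop n (N j)"
    and one: "wot_has_sum (\<lambda>j. adj (\<gamma> j) o\<^sub>L \<gamma> j) (idop n) J"
    and sum: "wot_has_sum (\<lambda>j. adj (\<gamma> j) o\<^sub>L y j o\<^sub>L \<gamma> j) U J"
    and j: "j \<in> J"
  shows "y j o\<^sub>L \<gamma> j = \<gamma> j o\<^sub>L U"
proof (rule blinfun_eqI)
  fix x
  have cl: "clinear_op (\<gamma> j)" if "j \<in> J" for j using \<gamma>[OF that] by (rule bopD)
  have nsum: "((\<lambda>j. (norm (\<gamma> j z))\<^sup>2) has_sum (norm (trunc n z))\<^sup>2) J" for z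
  proof -
    have "((\<lambda>j. Re (cinner z ((adj (\<gamma> j) o\<^sub>L \<gamma> j) z))) has_sum Re (cinner z (idop n z))) J"
      using one by (intro has_sum_Re) (auto simp: wot_has_sum_def)
    moreover have "Re (cinner z (idop n z)) = (norm (trunc n z))\<^sup>2"
      by (metis Re_complex_of_real cinner_self cinner_trunc idop.rep_eq trunc_trunc)
    moreover have "Re (cinner z ((adj (\<gamma> j) o\<^sub>L \<gamma> j) z)) = (norm (\<gamma> j z))\<^sup>2" if "j \<in> J" for j
      by (simp only: norm_sq_adj_comp[OF cl[OF that]] Re_complex_of_real)
    ultimately show ?thesis by (simp only: cong: has_sum_cong) simp
  qed
  have csum: "((\<lambda>j. Re (cinner (\<gamma> j (U x)) (y j (\<gamma> j x)))) has_sum (norm (U x))\<^sup>2) J"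
  proof -
    have "((\<lambda>j. Re (cinner (U x) ((adj (\<gamma> j) o\<^sub>L y j o\<^sub>L \<gamma> j) x))) has_sum Re (cinner (U x) (U x))) J"
      using sum by (intro has_sum_Re) (auto simp: wot_has_sum_def)
    moreover have "Re (cinner (U x) ((adj (\<gamma> j) o\<^sub>L y j o\<^sub>L \<gamma> j) x))
        = Re (cinner (\<gamma> j (U x)) (y j (\<gamma> j x)))" if "j \<in> J" for j
      by (simp add: cinner_adj[OF cl[OF that]])
    moreover have "Re (cinner (U x) (U x)) = (norm (U x))\<^sup>2"
      by (simp add: cinner_self)
    ultimately show ?thesis by (simp only: cong: has_sum_cong) simp
  qed
  define u where "u j = (norm (\<gamma> j x))\<^sup>2 + - 2 * Re (cinner (\<gamma> j (U x)) (y j (\<gamma> j x)))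
    + (norm (\<gamma> j (U x)))\<^sup>2" for j
  have "trunc n (U x) = U x" using U bopD(5)[of U n n] by (simp add: unitary_op_def)
  then have "(u has_sum ((norm (trunc n x))\<^sup>2 + - 2 * (norm (U x))\<^sup>2 + (norm (U x))\<^sup>2)) J"
    unfolding u_def using nsum[of "U x"]
    by (intro has_sum_add has_sum_cmult_right nsum csum) simp
  then have 0: "(u has_sum 0) J" by (simp add: norm_unitary_op[OF U])
  have *: "(norm (y j (\<gamma> j x) - \<gamma> j (U x)))\<^sup>2 \<le> u j" if "j \<in> J" for j
  proof -
    have "(norm (y j (\<gamma> j x)))\<^sup>2 \<le> (norm (\<gamma> j x))\<^sup>2"
      using y[OF that] by (intro power_mono) (auto simp: contraction_def)
    then show ?thesis unfolding u_def norm_sq_diff by simp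
  qed
  have "u j = 0"
    by (rule nonneg_has_sum_le_0D[OF 0 order_refl _ j]) (use * in \<open>meson order_trans zero_le_power2\<close>)
  with *[OF j] have "y j (\<gamma> j x) - \<gamma> j (U x) = 0" by simp
  then show "(y j o\<^sub>L \<gamma> j) x = (\<gamma> j o\<^sub>L U) x" by simp
qed


section \<open>Irreducible unitary points are noncommutative extreme points\<close>

text \<open>Both equations are needed: the second is the adjoint of the first for \<open>(y i)\<^sup>*\<close>, and together they
  make \<open>\<gamma>\<^sup>*\<gamma>\<close> commute with \<open>x i\<close>.\<close>

definition intertwines :: "op \<Rightarrow> ('i \<Rightarrow> op) \<Rightarrow> ('i \<Rightarrow> op) \<Rightarrow> 'i \<Rightarrow> bool" where
  "intertwines \<gamma> x y i \<longleftrightarrow> y i o\<^sub>L \<gamma> = \<gamma> o\<^sub>L x i \<and> adj \<gamma> o\<^sub>L y i = x i o\<^sub>L adj \<gamma>"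

text \<open>A point of a graded set whose coordinates in \<open>S\<close> are unitaries with trivial commutant, while the
  coordinates in \<open>S\<close> of every other point are contractions. The set \<open>S\<close> plays the role of a generating
  set: an intertwiner for the coordinates in \<open>S\<close> is one for all coordinates. For tuples \<open>S\<close> is the
  whole index set; for maps on the span of some unitaries it consists of these unitaries, and the
  remaining coordinates are controlled by linearity.\<close>

locale unitary_generators =
  fixes K :: "'i graded" and n :: enat and x :: "'i \<Rightarrow> op" and S :: "'i set"
  assumes nonzero: "n \<noteq> 0"
    and mem: "x \<in> K n"
    and unitary: "i \<in> S \<Longrightarrow> unitary_op n (x i)"
    and bounded: "y \<in> K m \<Longrightarrow> y i \<in> bop m m"
    and contraction: "y \<in> K m \<Longrightarrow> i \<in> S \<Longrightarrow> contraction (y i)"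
    and determined: "y \<in> K m \<Longrightarrow> \<gamma> \<in> bop n m \<Longrightarrow> (\<And>i. i \<in> S \<Longrightarrow> intertwines \<gamma> x y i)
      \<Longrightarrow> intertwines \<gamma> x y i"
    and irreducible: "A \<in> bop n n \<Longrightarrow> (\<And>i. i \<in> S \<Longrightarrow> A o\<^sub>L x i = x i o\<^sub>L A)
      \<Longrightarrow> \<exists>c. A = scale_op c (idop n)"
    and compress_closed: "y \<in> K N \<Longrightarrow> m \<noteq> 0 \<Longrightarrow> isometry_op m N V \<Longrightarrow> compress V y V \<in> K m"
begin

text \<open>In a decomposition of \<open>x\<close> every \<open>\<gamma> j\<close> intertwines, because the compression of contractions to
  the unitaries \<open>x i\<close> and to their adjoints splits off.\<close>

lemma sum_intertwines:
  assumes y: "\<And>j. j \<in> J \<Longrightarrow> y j \<in> K (N j)"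
    and \<gamma>: "\<And>j. j \<in> J \<Longrightarrow> \<gamma> j \<in> bop n (N j)"
    and one: "wot_has_sum (\<lambda>j. adj (\<gamma> j) o\<^sub>L \<gamma> j) (idop n) J"
    and sum: "\<And>i. wot_has_sum (\<lambda>j. compress (\<gamma> j) (y j) (\<gamma> j) i) (x i) J"
    and j: "j \<in> J"
  shows "intertwines (\<gamma> j) x (y j) i"
proof (rule determined[OF y[OF j] \<gamma>[OF j]])
  fix i assume i: "i \<in> S"
  have yi: "y j i \<in> bop (N j) (N j)" "contraction (y j i)" if "j \<in> J" for j
    using contraction[OF y[OF that] i] bounded[OF y[OF that]] by auto
  note cl = bopD(1)[OF yi(1)] bopD(1)[OF \<gamma>]
  have x: "clinear_op (x i)" using unitary[OF i] bopD(1)[of "x i" n n] by (simp add: unitary_op_def)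
  have 1: "y j i o\<^sub>L \<gamma> j = \<gamma> j o\<^sub>L x i"
    using sum[of i] by (intro contraction_intertwines_unitary[OF unitary[OF i] _ \<gamma> one _ j])
      (auto simp: compress_def yi)
  have "wot_has_sum (\<lambda>j. adj (compress (\<gamma> j) (y j) (\<gamma> j) i)) (adj (x i)) J"
    by (rule wot_has_sum_adj[OF sum _ x]) (auto simp: compress_def intro!: clinear_comp clinear_adj cl)
  then have "wot_has_sum (\<lambda>j. adj (\<gamma> j) o\<^sub>L adj (y j i) o\<^sub>L \<gamma> j) (adj (x i)) J"
    unfolding wot_has_sum_def
    by (simp add: compress_def adj_comp clinear_comp clinear_adj cl adj_adj cong: has_sum_cong)
  then have "adj (y j i) o\<^sub>L \<gamma> j = \<gamma> j o\<^sub>L adj (x i)"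
    by (intro contraction_intertwines_unitary[OF unitary_op_adj[OF unitary[OF i]] _ \<gamma> one _ j])
      (auto intro: contraction_adj cl yi)
  from arg_cong[OF this, of adj] have "adj (\<gamma> j) o\<^sub>L y j i = x i o\<^sub>L adj (\<gamma> j)"
    by (simp add: adj_comp clinear_adj cl j adj_adj x)
  with 1 show "intertwines (\<gamma> j) x (y j) i" by (simp add: intertwines_def)
qed

text \<open>By Schur's lemma \<open>\<gamma>\<^sup>*\<gamma>\<close> is a scalar, which makes \<open>\<gamma>\<close> a multiple of an isometry.\<close>

lemma pure: "nc_pure K n x"
  unfolding nc_pure_def
proof (intro conjI allI impI ballI)
  show "x \<in> K n" by (rule mem)
next
  fix J :: "nat set" and N y \<gamma> j
  assume *: "(\<forall>j\<in>J. N j \<noteq> 0 \<and> y j \<in> K (N j) \<and> \<gamma> j \<in> bop n (N j) \<and> \<gamma> j \<noteq> 0) \<and>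
        (\<exists>C. \<forall>j\<in>J. norm (\<gamma> j) \<le> C) \<and>
        wot_has_sum (\<lambda>j. adj (\<gamma> j) o\<^sub>L \<gamma> j) (idop n) J \<and>
        (\<forall>i. wot_has_sum (\<lambda>j. compress (\<gamma> j) (y j) (\<gamma> j) i) (x i) J)" and j: "j \<in> J"
  define g where "g = \<gamma> j"
  have g: "g \<in> bop n (N j)" "g \<noteq> 0" using * j by (auto simp: g_def)
  note cl = bopD(1)[OF g(1)]
  have int: "intertwines g x (y j) i" for i
    unfolding g_def using * by (intro sum_intertwines[OF _ _ _ _ j]) auto
  have comm: "adj g o\<^sub>L g o\<^sub>L x i = x i o\<^sub>L (adj g o\<^sub>L g)" for i
  proof -
    have "adj g o\<^sub>L g o\<^sub>L x i = (adj g o\<^sub>L y j i) o\<^sub>L g"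
      using arg_cong[OF conjunct1[OF int[unfolded intertwines_def]], of "\<lambda>T. adj g o\<^sub>L T"]
      by (simp only: op_assoc)
    also have "\<dots> = (x i o\<^sub>L adj g) o\<^sub>L g"
      using int[of i] by (simp add: intertwines_def)
    finally show ?thesis by (simp only: op_assoc)
  qed
  then obtain c where c: "adj g o\<^sub>L g = scale_op c (idop n)"
    using irreducible[of "adj g o\<^sub>L g"] bop_comp[OF bop_adj[OF g(1)] g(1)] by blast
  \<comment> \<open>the level is nonzero, so the scalar can be read off at the first basis vector\<close>
  define r where "r = norm (g (basis_vec 0))"
  have "trunc n (basis_vec 0) = basis_vec 0"
    using nonzero by (intro ell2_eqI) (auto simp: coord_simps zero_enat_def[symmetric])
  then have "cinner (basis_vec 0) (scale_op c (idop n) (basis_vec 0)) = c"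
    by (simp add: scale_op_apply idop.rep_eq cinner_basis_left coord_simps)
  then have cr: "c = of_real (r\<^sup>2)"
    unfolding c[symmetric] norm_sq_adj_comp[OF cl] r_def by simp
  have "r \<noteq> 0"
  proof
    assume "r = 0"
    then have "adj g o\<^sub>L g = 0"
      by (simp add: c cr blinfun_eqI scale_op_apply)
    then have "(norm (g z))\<^sup>2 = 0" for z
      using norm_sq_adj_comp[OF cl, of z] by simp
    then have "g = 0" by (intro blinfun_eqI) simp
    with g show False by simp
  qed
  define \<nu> where "\<nu> = scale_op (1 / of_real r) g"
  have \<nu>_comp: "adj \<nu> o\<^sub>L T o\<^sub>L \<nu> = scale_op (1 / c) (adj g o\<^sub>L T o\<^sub>L g)" if "clinear_op T" for T
    using that clinear_adj[OF cl]
    by (intro blinfun_eqI) (simp add: \<nu>_def adj_scale_op[OF cl] scale_op_apply cr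
      clinear_op_def scaleC_simps power2_eq_square)
  show "\<exists>c \<nu>. isometry_op n (N j) \<nu> \<and> \<gamma> j = scale_op c \<nu> \<and> compress \<nu> (y j) \<nu> = x"
  proof (intro exI conjI)
    have "adj \<nu> o\<^sub>L \<nu> = idop n"
    proof -
      have id: "S o\<^sub>L id_blinfun o\<^sub>L T = S o\<^sub>L T" for S T :: op
        by (rule blinfun_eqI) simp
      have "adj \<nu> o\<^sub>L \<nu> = scale_op (1 / c) (adj g o\<^sub>L g)"
        using \<nu>_comp[of "id_blinfun"] by (simp add: id clinear_op_def)
      then show ?thesis
        unfolding c using \<open>r \<noteq> 0\<close>
        by (intro blinfun_eqI) (simp add: cr scale_op_apply scaleC_simps)
    qed
    then show "isometry_op n (N j) \<nu>"
      by (simp add: isometry_op_def \<nu>_def bop_scale_op g)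
    show "\<gamma> j = scale_op (of_real r) \<nu>"
      using \<open>r \<noteq> 0\<close> by (intro blinfun_eqI) (simp add: \<nu>_def g_def scale_op_apply scaleC_simps)
    show "compress \<nu> (y j) \<nu> = x"
    proof
      fix i
      have "clinear_op (y j i)"
        using * j bounded bopD(1) by blast
      then have "compress \<nu> (y j) \<nu> i = scale_op (1 / c) (adj g o\<^sub>L y j i o\<^sub>L g)"
        by (simp add: compress_def \<nu>_comp)
      also have "adj g o\<^sub>L y j i o\<^sub>L g = adj g o\<^sub>L g o\<^sub>L x i"
        using int[of i] comm[of i] by (simp add: intertwines_def op_assoc)
      also have "scale_op (1 / c) \<dots> = idop n o\<^sub>L x i"
        using \<open>r \<noteq> 0\<close> by (intro blinfun_eqI) (simp add: c cr scale_op_apply scaleC_simps)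
      also have "\<dots> = x i" by (rule bopD(3)[OF bounded[OF mem]])
      finally show "compress \<nu> (y j) \<nu> i = x i" .
    qed
  qed
qed

text \<open>A dilation is the decomposition of \<open>x\<close> with the single term \<open>V\<^sup>*yV\<close>, so \<open>V\<close> intertwines; the
  off-diagonal corners then contain the factor \<open>U\<^sup>*V = 0\<close>.\<close>

lemma maximal: "nc_maximal K n x"
  unfolding nc_maximal_def
proof (intro conjI allI impI)
  show "x \<in> K n" by (rule mem)
next
  fix m N V U y
  assume *: "m \<noteq> 0 \<and> isometry_op n N V \<and> isometry_op m N U \<and>
        (V o\<^sub>L adj V) + (U o\<^sub>L adj U) = idop N \<and> y \<in> K N \<and> compress V y V = x"
  then have V: "V \<in> bop n N" "adj V o\<^sub>L V = idop n" and U: "U \<in> bop m N" "adj U o\<^sub>L U = idop m"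
    and VU: "(V o\<^sub>L adj V) + (U o\<^sub>L adj U) = idop N"
    by (auto simp: isometry_op_def)
  have int: "intertwines V x y i" for i
  proof (rule sum_intertwines[of "{0::nat}" "\<lambda>_. y" "\<lambda>_. N" "\<lambda>_. V" 0])
    show "wot_has_sum (\<lambda>j. adj V o\<^sub>L V) (idop n) {0 :: nat}"
      by (auto simp: wot_has_sum_def V intro: has_sum_finiteI)
    show "wot_has_sum (\<lambda>j. compress V y V i) (x i) {0 :: nat}" for i
      using * by (auto simp: wot_has_sum_def intro: has_sum_finiteI)
  qed (use * V in auto)
  \<comment> \<open>the ranges of the two isometries are orthogonal since their projections add up to 1\<close>
  have "(V o\<^sub>L (adj V o\<^sub>L V)) + (U o\<^sub>L (adj U o\<^sub>L V)) = idop N o\<^sub>L V"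
    unfolding VU[symmetric] by (intro blinfun_eqI) (simp add: blinfun.add_left)
  then have "U o\<^sub>L (adj U o\<^sub>L V) = 0" by (simp add: V(2) bopD(2,3)[OF V(1)])
  then have "adj U o\<^sub>L (U o\<^sub>L (adj U o\<^sub>L V)) = 0" by simp
  then have UV: "adj U o\<^sub>L V = 0"
    by (simp add: op_assoc[symmetric] U bopD[OF bop_adj[OF U(1)]])
  from arg_cong[OF this, of adj] have VU0: "adj V o\<^sub>L U = 0"
    by (simp add: adj_comp adj_adj clinear_adj bopD(1)[OF V(1)] bopD(1)[OF U(1)])
  show "compress V y U = 0"
  proof
    fix i
    have "compress V y U i = x i o\<^sub>L (adj V o\<^sub>L U)"
      unfolding compress_def op_assoc[symmetric] using int[of i] by (simp add: intertwines_def)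
    then show "compress V y U i = 0 i" by (simp add: VU0)
  qed
  show "compress U y V = 0"
  proof
    fix i
    have "compress U y V i = (adj U o\<^sub>L V) o\<^sub>L x i"
      using int[of i] by (simp add: compress_def intertwines_def op_assoc)
    then show "compress U y V i = 0 i" by (simp add: UV)
  qed
  show "compress U y U \<in> K m"
    using * by (intro compress_closed) auto
qed

lemma extreme: "nc_extreme K n x"
  by (simp add: nc_extreme_def pure maximal)

end


section \<open>Unital completely positive maps on full group C*-algebras\<close>

lemma ucpD:
  assumes "ucp A R n \<phi>"
  shows "a \<notin> R \<Longrightarrow> \<phi> a = 0"
    and "a \<in> R \<Longrightarrow> \<phi> a \<in> bop n n"
    and "a \<in> R \<Longrightarrow> b \<in> R \<Longrightarrow> \<phi> (a + b) = \<phi> a + \<phi> b"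
    and "a \<in> R \<Longrightarrow> \<phi> (scale_fam c a) = scale_op c (\<phi> a)"
    and "\<phi> \<one>\<^bsub>A\<^esub> = idop n"
    and "(\<And>i j. i < m \<Longrightarrow> j < m \<Longrightarrow> X i j \<in> R) \<Longrightarrow> pos_matrix A m X
      \<Longrightarrow> pos_op_matrix m (\<lambda>i j. \<phi> (X i j))"
  using assms unfolding ucp_def by simp_all

lemma ucpI:
  assumes "\<And>a. a \<notin> R \<Longrightarrow> \<phi> a = 0"
    and "\<And>a. a \<in> R \<Longrightarrow> \<phi> a \<in> bop n n"
    and "\<And>a b. a \<in> R \<Longrightarrow> b \<in> R \<Longrightarrow> \<phi> (a + b) = \<phi> a + \<phi> b"
    and "\<And>c a. a \<in> R \<Longrightarrow> \<phi> (scale_fam c a) = scale_op c (\<phi> a)"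
    and "\<phi> \<one>\<^bsub>A\<^esub> = idop n"
    and "\<And>m X. (\<And>i j. i < m \<Longrightarrow> j < m \<Longrightarrow> X i j \<in> R) \<Longrightarrow> pos_matrix A m X
      \<Longrightarrow> pos_op_matrix m (\<lambda>i j. \<phi> (X i j))"
  shows "ucp A R n \<phi>"
  unfolding ucp_def using assms by simp

lemma cspan_bop:
  assumes "\<And>a. a \<in> A \<Longrightarrow> a \<rho> \<in> bop n n" "a \<in> cspan A"
  shows "a \<rho> \<in> bop n n"
  using assms(2) unfolding cspan_def
proof (induction rule: fam.span_induct_alt)
  case base
  then show ?case by (simp add: bop_zero)
next
  case (step c x y)
  then show ?case by (simp add: scale_fam_def bop_add bop_scale_op assms(1))
qed

lemma cspan_base: "a \<in> A \<Longrightarrow> a \<in> cspan A"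
  unfolding cspan_def by (rule fam.span_base)

lemma cspan_add: "a \<in> cspan A \<Longrightarrow> b \<in> cspan A \<Longrightarrow> a + b \<in> cspan A"
  unfolding cspan_def by (rule fam.span_add)

lemma cspan_scale: "a \<in> cspan A \<Longrightarrow> scale_fam c a \<in> cspan A"
  unfolding cspan_def by (rule fam.span_scale)

lemma cspan_zero: "0 \<in> cspan A"
  unfolding cspan_def by (rule fam.span_zero)

lemma cinner_sum_left: "cinner (sum f A) x = (\<Sum>a\<in>A. cinner (f a) x)"
  by (subst cinner_cnj) (simp add: cinner_sum_right cinner_cnj[symmetric])

context
  fixes G :: "('g, 'm) monoid_scheme"
  assumes G: "group G"
begin

interpretation group G by (rule G)

lemma unitary_repsD:
  assumes "(n, \<pi>) \<in> unitary_reps G"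
  shows "g \<in> carrier G \<Longrightarrow> unitary_op n (\<pi> g)"
    and "g \<in> carrier G \<Longrightarrow> h \<in> carrier G \<Longrightarrow> \<pi> (g \<otimes>\<^bsub>G\<^esub> h) = \<pi> g o\<^sub>L \<pi> h"
    and "\<pi> \<one>\<^bsub>G\<^esub> = idop n"
proof -
  have \<pi>: "\<pi> \<in> hom G (unitary_group n)" using assms by (auto simp: unitary_reps_def)
  show u: "unitary_op n (\<pi> g)" if "g \<in> carrier G" for g
    using hom_in_carrier[OF \<pi> that] by (simp add: unitary_group_def unitary_op_def)
  show m: "\<pi> (g \<otimes>\<^bsub>G\<^esub> h) = \<pi> g o\<^sub>L \<pi> h" if "g \<in> carrier G" "h \<in> carrier G" for g h
    using hom_mult[OF \<pi> that] by (simp add: unitary_group_def)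
  have "adj (\<pi> \<one>\<^bsub>G\<^esub>) o\<^sub>L \<pi> \<one>\<^bsub>G\<^esub> = (adj (\<pi> \<one>\<^bsub>G\<^esub>) o\<^sub>L \<pi> \<one>\<^bsub>G\<^esub>) o\<^sub>L \<pi> \<one>\<^bsub>G\<^esub>"
    using m[of "\<one>\<^bsub>G\<^esub>" "\<one>\<^bsub>G\<^esub>"] by (simp add: op_assoc)
  also have "\<dots> = \<pi> \<one>\<^bsub>G\<^esub>"
    using u[OF one_closed] bopD(3)[of "\<pi> \<one>\<^bsub>G\<^esub>" n n] by (simp add: unitary_op_def)
  finally show "\<pi> \<one>\<^bsub>G\<^esub> = idop n"
    using u[OF one_closed] by (simp add: unitary_op_def)
qed

lemma group_unitary_mult:
  assumes "g \<in> carrier G" "h \<in> carrier G"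
  shows "group_unitary G g \<otimes>\<^bsub>full_cstar G\<^esub> group_unitary G h = group_unitary G (g \<otimes>\<^bsub>G\<^esub> h)"
  using assms
  by (auto simp: full_cstar_def group_unitary_def fun_eq_iff unitary_repsD)

lemma star_group_unitary:
  assumes g: "g \<in> carrier G"
  shows "star (group_unitary G g) = group_unitary G (inv\<^bsub>G\<^esub> g)"
proof
  fix \<rho> :: "enat \<times> ('g \<Rightarrow> op)"
  obtain n \<pi> where \<rho>: "\<rho> = (n, \<pi>)" by (cases \<rho>)
  show "star (group_unitary G g) \<rho> = group_unitary G (inv\<^bsub>G\<^esub> g) \<rho>"
  proof (cases "\<rho> \<in> unitary_reps G")
    case True
    note rep = unitary_repsD[OF True[unfolded \<rho>]]
    have u: "unitary_op n (\<pi> g)" "unitary_op n (\<pi> (inv\<^bsub>G\<^esub> g))" using g rep(1) by auto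
    have "adj (\<pi> g) = adj (\<pi> g) o\<^sub>L (\<pi> g o\<^sub>L \<pi> (inv\<^bsub>G\<^esub> g))"
      using g u bopD(2)[OF bop_adj, of "\<pi> g" n n] by (simp add: rep(2)[symmetric] rep(3) unitary_op_def)
    also have "\<dots> = \<pi> (inv\<^bsub>G\<^esub> g)"
      using u bopD(3)[of "\<pi> (inv\<^bsub>G\<^esub> g)" n n] by (simp add: op_assoc[symmetric] unitary_op_def)
    finally show ?thesis using True by (simp add: star_def group_unitary_def \<rho>)
  qed (simp add: star_def group_unitary_def)
qed

lemma group_unitary_in_full_cstar:
  assumes "g \<in> carrier G"
  shows "group_unitary G g \<in> carrier (full_cstar G)"
  using cspan_base[OF imageI[OF assms], of "group_unitary G"]
  by (force simp: full_cstar_def)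

lemma zero_in_full_cstar: "0 \<in> carrier (full_cstar G)"
  using cspan_zero[of "group_unitary G ` carrier G"] by (force simp: full_cstar_def)

lemma group_unitary_pow:
  assumes "g \<in> carrier G"
  shows "group_unitary G g [^]\<^bsub>full_cstar G\<^esub> (i :: nat) = group_unitary G (g [^]\<^bsub>G\<^esub> i)"
proof (induction i)
  case 0
  then show ?case by (simp add: nat_pow_def full_cstar_def)
next
  case (Suc i)
  have "group_unitary G g [^]\<^bsub>full_cstar G\<^esub> Suc i
      = group_unitary G g [^]\<^bsub>full_cstar G\<^esub> i \<otimes>\<^bsub>full_cstar G\<^esub> group_unitary G g"
    by (simp add: nat_pow_def)
  with Suc show ?case by (simp add: group_unitary_mult assms)
qed

text \<open>Norm limits of complex-linear operators are complex-linear; this is what gives meaning to the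
  adjoints in the definition of a positive matrix.\<close>

lemma full_cstar_clinear:
  assumes a: "a \<in> carrier (full_cstar G)" and \<rho>: "\<rho> \<in> unitary_reps G"
  shows "clinear_op (a \<rho>)"
  unfolding clinear_op_def
proof (intro allI)
  fix c x
  obtain n \<pi> where \<rho>': "\<rho> = (n, \<pi>)" by (cases \<rho>)
  let ?d = "a \<rho> (scaleC c x) - scaleC c (a \<rho> x)"
  have "norm ?d \<le> \<epsilon> * (2 * cmod c * norm x)" if "\<epsilon> > 0" for \<epsilon>
  proof -
    obtain b where b: "b \<in> cspan (group_unitary G ` carrier G)" "norm (a \<rho> - b \<rho>) \<le> \<epsilon>"
      using a \<open>\<epsilon> > 0\<close>
      unfolding full_cstar_def partial_object.select_convs mem_Collect_eq by blast
    have "b \<rho> \<in> bop n n"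
      using \<rho> unitary_repsD(1)[OF \<rho>[unfolded \<rho>']]
      by (intro cspan_bop[OF _ b(1)]) (auto simp: group_unitary_def \<rho>' unitary_op_def)
    then have "b \<rho> (scaleC c x) = scaleC c (b \<rho> x)"
      using bopD(1) by (auto simp: clinear_op_def)
    then have "?d = (a \<rho> - b \<rho>) (scaleC c x) - scaleC c ((a \<rho> - b \<rho>) x)"
      by (simp add: blinfun.diff_left linear_diff[OF bounded_linear.linear[OF bounded_linear_scaleC]])
    also have "norm \<dots> \<le> norm ((a \<rho> - b \<rho>) (scaleC c x)) + norm (scaleC c ((a \<rho> - b \<rho>) x))"
      by (rule norm_triangle_ineq4)
    also have "\<dots> \<le> \<epsilon> * norm (scaleC c x) + cmod c * (\<epsilon> * norm x)"
      unfolding norm_scaleC[of c "(a \<rho> - b \<rho>) x"]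
      by (intro add_mono mult_left_mono order_trans[OF norm_blinfun] mult_right_mono b) auto
    finally show ?thesis by (simp add: norm_scaleC algebra_simps)
  qed
  note le = this
  define M where "M = 2 * cmod c * norm x"
  have "M \<ge> 0" by (simp add: M_def)
  have "norm ?d \<le> 0 + e" if "e > 0" for e :: real
  proof -
    have "norm ?d \<le> e / (M + 1) * M"
      unfolding M_def using that by (intro le divide_pos_pos add_nonneg_pos) auto
    also have "\<dots> \<le> e" using that \<open>M \<ge> 0\<close> by (simp add: field_simps)
    finally show ?thesis by simp
  qed
  then have "norm ?d \<le> 0" by (rule field_le_epsilon)
  then show "a \<rho> (scaleC c x) = scaleC c (a \<rho> x)" by simp
qed

text \<open>The matrix with rows \<open>1, u\<close> and \<open>u\<^sup>*, 1\<close> is positive, as it equals \<open>B\<^sup>*B\<close> for \<open>B\<close> with first row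
  \<open>1, u\<close> and second row \<open>0\<close>. Positivity of its image at the vector \<open>(- T x, x)\<close>, with
  \<open>T = \<phi> u\<close>, is the inequality \<open>\<parallel>T x\<parallel> \<le> \<parallel>x\<parallel>\<close>.\<close>

lemma ucp_contraction:
  assumes \<phi>: "ucp (full_cstar G) R n \<phi>" and g: "g \<in> carrier G"
    and R: "group_unitary G \<one>\<^bsub>G\<^esub> \<in> R" "group_unitary G g \<in> R" "star (group_unitary G g) \<in> R"
  shows "contraction (\<phi> (group_unitary G g))"
  unfolding contraction_def
proof
  fix x
  let ?u = "group_unitary G g" and ?one = "group_unitary G \<one>\<^bsub>G\<^esub>"
  define X where "X i j = (if i = j then ?one else if i < j then ?u else star ?u)" for i j :: nat
  define B where "B i j = (if i = 0 then if j = 0 then ?one else ?u else 0)" for i j :: nat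
  have "pos_matrix (full_cstar G) 2 X"
    unfolding pos_matrix_def
  proof (rule exI[of _ B], intro conjI allI impI)
    show "B i j \<in> carrier (full_cstar G)" for i j
      by (simp add: B_def group_unitary_in_full_cstar zero_in_full_cstar g)
    fix i j :: nat assume "i < 2" "j < 2"
    have z: "star 0 \<otimes>\<^bsub>full_cstar G\<^esub> 0 = (0 :: 'g opfam)"
      by (simp add: full_cstar_def fun_eq_iff)
    from \<open>i < 2\<close> \<open>j < 2\<close> have "i = 0 \<or> i = 1" "j = 0 \<or> j = 1" by auto
    then show "X i j = (\<Sum>l<2. star (B l i) \<otimes>\<^bsub>full_cstar G\<^esub> B l j)"
      using g by (auto simp: X_def B_def numeral_2_eq_2 z star_group_unitary group_unitary_mult)
  qed
  moreover have "\<forall>i<2. \<forall>j<2. X i j \<in> R" using R by (simp add: X_def)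
  ultimately have pos: "pos_op_matrix 2 (\<lambda>i j. \<phi> (X i j))"
    using \<phi> unfolding ucp_def by blast
  have one: "\<phi> ?one = idop n" using \<phi> by (simp add: ucp_def full_cstar_def)
  let ?T = "\<phi> ?u" and ?S = "\<phi> (star ?u)"
  have T: "?T \<in> bop n n" "?S \<in> bop n n" using \<phi> R by (auto simp: ucp_def)
  have P: "cinner a (trunc n a) + cinner a (?T b) + (cinner b (?S a) + cinner b (trunc n b)) \<in> \<real>\<^sub>\<ge>\<^sub>0"
    for a b
    using pos[unfolded pos_op_matrix_def, rule_format, of "\<lambda>i. if i = 0 then a else b"]
    by (simp add: numeral_2_eq_2 X_def one idop.rep_eq)
  have sq: "cinner a (trunc n a) = of_real ((norm (trunc n a))\<^sup>2)" for a
    by (metis cinner_self cinner_trunc trunc_trunc)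
  have real: "Im (cinner a (?T b)) + Im (cinner b (?S a)) = 0" for a b
    using P[of a b] by (auto simp: sq complex_nonneg_Reals_iff simp del: of_real_power)
  \<comment> \<open>the form takes real values only, which forces the image of the adjoint to be the adjoint of the image\<close>
  have Re: "Re (cinner b (?S a)) = Re (cinner a (?T b))" for a b
    using real[of "scaleC \<i> a" b] bopD(1)[OF T(2)]
    by (simp add: cinner_scaleC_left cinner_scaleC_right clinear_op_def)
  have "0 \<le> (norm (trunc n a))\<^sup>2 + Re (cinner a (?T b))
      + (Re (cinner b (?S a)) + (norm (trunc n b))\<^sup>2)" for a b
    using P[of a b] by (auto simp: sq complex_nonneg_Reals_iff simp del: of_real_power)
  from this[of "- ?T x" x]
  have "0 \<le> (norm (trunc n (- ?T x)))\<^sup>2 + 2 * Re (cinner (- ?T x) (?T x)) + (norm (trunc n x))\<^sup>2"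
    by (simp add: Re)
  moreover have "Re (cinner (- ?T x) (?T x)) = - (norm (?T x))\<^sup>2"
    by (simp only: inner_ell2_def[symmetric] inner_minus_left power2_norm_eq_inner)
  moreover have "(norm (trunc n (- ?T x)))\<^sup>2 \<le> (norm (?T x))\<^sup>2"
    using norm_trunc_le[of n "- ?T x"] by (intro power_mono) auto
  ultimately have "(norm (?T x))\<^sup>2 \<le> (norm (trunc n x))\<^sup>2" by linarith
  then have "(norm (?T x))\<^sup>2 \<le> (norm x)\<^sup>2"
    using power_mono[OF norm_trunc_le[of n x], of 2] by simp
  then show "norm (?T x) \<le> norm x" by (simp add: power2_le_iff_abs_le)
qed

text \<open>A representation is one of the blocks of the universal representation, so evaluation at that block
  is the associated *-homomorphism.\<close>

lemma ucp_rep: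
  assumes rep: "(n, \<pi>) \<in> unitary_reps G"
    and R: "R \<subseteq> cspan (group_unitary G ` carrier G)" "group_unitary G \<one>\<^bsub>G\<^esub> \<in> R"
      "\<And>a b. a \<in> R \<Longrightarrow> b \<in> R \<Longrightarrow> a + b \<in> R" "\<And>c a. a \<in> R \<Longrightarrow> scale_fam c a \<in> R"
  shows "ucp (full_cstar G) R n (\<lambda>a. if a \<in> R then a (n, \<pi>) else 0)"
proof -
  have bop: "a (n, \<pi>) \<in> bop n n" if "a \<in> R" for a
  proof (rule cspan_bop[of "group_unitary G ` carrier G"])
    show "a \<in> cspan (group_unitary G ` carrier G)" using that R(1) by (rule rev_subsetD)
    show "u (n, \<pi>) \<in> bop n n" if "u \<in> group_unitary G ` carrier G" for u
      using that rep unitary_repsD(1)[OF rep] by (auto simp: group_unitary_def unitary_op_def)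
  qed
  have pos: "pos_op_matrix m (\<lambda>i j. if X i j \<in> R then X i j (n, \<pi>) else 0)"
    if XR: "\<And>i j. i < m \<Longrightarrow> j < m \<Longrightarrow> X i j \<in> R" and X: "pos_matrix (full_cstar G) m X" for m X
    unfolding pos_op_matrix_def
  proof
    fix \<xi> :: "nat \<Rightarrow> ell2"
    obtain B where B: "\<forall>i<m. \<forall>j<m. B i j \<in> carrier (full_cstar G)"
      "\<forall>i<m. \<forall>j<m. X i j = (\<Sum>l<m. star (B l i) \<otimes>\<^bsub>full_cstar G\<^esub> B l j)"
      using X by (auto simp: pos_matrix_def)
    define b where "b l j = B l j (n, \<pi>)" for l j
    define z where "z l = (\<Sum>j<m. b l j (\<xi> j))" for l
    have cb: "clinear_op (b i j)" if "i < m" "j < m" for i j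
      unfolding b_def using B(1) that rep by (intro full_cstar_clinear) auto
    have sum_fam: "(\<Sum>l\<in>I. f l) \<rho> = (\<Sum>l\<in>I. f l \<rho>)" for f :: "nat \<Rightarrow> 'g opfam" and I \<rho>
      by (induction I rule: infinite_finite_induct) auto
    have "cinner (\<xi> i) ((if X i j \<in> R then X i j (n, \<pi>) else 0) (\<xi> j))
        = (\<Sum>l<m. cinner (b l i (\<xi> i)) (b l j (\<xi> j)))" if ij: "i < m" "j < m" for i j
    proof -
      have "X i j (n, \<pi>) = (\<Sum>l<m. adj (b l i) o\<^sub>L b l j)"
        using B(2) ij by (simp add: sum_fam full_cstar_def star_def b_def)
      then have "cinner (\<xi> i) (X i j (n, \<pi>) (\<xi> j))
          = (\<Sum>l<m. cinner (\<xi> i) (adj (b l i) (b l j (\<xi> j))))"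
        by (simp add: blinfun.sum_left cinner_sum_right)
      also have "\<dots> = (\<Sum>l<m. cinner (b l i (\<xi> i)) (b l j (\<xi> j)))"
        using ij by (intro sum.cong HOL.refl) (simp add: cinner_adj[OF cb])
      finally show ?thesis using XR[OF ij] by simp
    qed
    then have "(\<Sum>i<m. \<Sum>j<m. cinner (\<xi> i) ((if X i j \<in> R then X i j (n, \<pi>) else 0) (\<xi> j)))
        = (\<Sum>i<m. \<Sum>j<m. \<Sum>l<m. cinner (b l i (\<xi> i)) (b l j (\<xi> j)))"
      by simp
    also have "\<dots> = (\<Sum>l<m. \<Sum>i<m. \<Sum>j<m. cinner (b l i (\<xi> i)) (b l j (\<xi> j)))"
      by (subst sum.swap[of _ "{..<m}" "{..<m}"], subst (2) sum.swap) (rule HOL.refl)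
    also have "\<dots> = (\<Sum>l<m. cinner (z l) (z l))"
      by (simp only: z_def cinner_sum_left) (simp only: cinner_sum_right)
    also have "\<dots> = of_real (\<Sum>l<m. (norm (z l))\<^sup>2)"
      by (simp add: cinner_self)
    also have "\<dots> \<in> \<real>\<^sub>\<ge>\<^sub>0"
      unfolding nonneg_Reals_of_real_iff by (intro sum_nonneg) simp
    finally show "(\<Sum>i<m. \<Sum>j<m. cinner (\<xi> i) ((if X i j \<in> R then X i j (n, \<pi>) else 0) (\<xi> j))) \<in> \<real>\<^sub>\<ge>\<^sub>0" .
  qed
  have "group_unitary G \<one>\<^bsub>G\<^esub> (n, \<pi>) = idop n"
    using rep by (simp add: group_unitary_def unitary_repsD(3))
  then show ?thesis
    by (intro ucpI pos) (use R bop in \<open>auto simp: full_cstar_def scale_fam_def\<close>)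
qed

end

lemma ucp_compress:
  assumes \<phi>: "ucp A R N \<phi>" and V: "isometry_op m N V"
  shows "ucp A R m (compress V \<phi> V)"
proof -
  have V: "V \<in> bop m N" "adj V o\<^sub>L V = idop m" using V by (auto simp: isometry_op_def)
  note cl = bopD(1)[OF V(1)] clinear_adj[OF bopD(1)[OF V(1)]]
  have pos: "pos_op_matrix l (\<lambda>i j. compress V \<phi> V (X i j))"
    if "pos_op_matrix l (\<lambda>i j. \<phi> (X i j))" for l X
    unfolding pos_op_matrix_def
  proof
    fix \<xi> :: "nat \<Rightarrow> ell2"
    show "(\<Sum>i<l. \<Sum>j<l. cinner (\<xi> i) (compress V \<phi> V (X i j) (\<xi> j))) \<in> \<real>\<^sub>\<ge>\<^sub>0"
      using that[unfolded pos_op_matrix_def, rule_format, of "\<lambda>i. V (\<xi> i)"]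
      by (simp add: compress_def cinner_adj[OF cl(1)])
  qed
  show ?thesis
  proof (rule ucpI)
    show "compress V \<phi> V a = 0" if "a \<notin> R" for a
      using ucpD(1)[OF \<phi> that] by (simp add: compress_def)
    show "compress V \<phi> V a \<in> bop m m" if "a \<in> R" for a
      using ucpD(2)[OF \<phi> that] by (auto simp: compress_def intro!: bop_comp V(1) bop_adj)
    show "compress V \<phi> V (a + b) = compress V \<phi> V a + compress V \<phi> V b"
      if "a \<in> R" "b \<in> R" for a b
      by (intro blinfun_eqI)
        (simp add: ucpD(3)[OF \<phi> that] compress_def blinfun.add_left blinfun.add_right)
    show "compress V \<phi> V (scale_fam c a) = scale_op c (compress V \<phi> V a)" if "a \<in> R" for c a
      using cl(2) by (intro blinfun_eqI)
        (simp add: ucpD(4)[OF \<phi> that] compress_def scale_op_apply clinear_op_def)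
    show "compress V \<phi> V \<one>\<^bsub>A\<^esub> = idop m"
      by (simp add: ucpD(5)[OF \<phi>] compress_def op_assoc bopD[OF V(1)] V(2))
    show "pos_op_matrix l (\<lambda>i j. compress V \<phi> V (X i j))"
      if "\<And>i j. i < l \<Longrightarrow> j < l \<Longrightarrow> X i j \<in> R" "pos_matrix A l X" for l X
      by (rule pos) (rule ucpD(6)[OF \<phi> that])
  qed
qed


section \<open>Homomorphisms out of a free product\<close>

text \<open>The universal property of the free product, with a monoid as target. Letters outside the carriers,
  which \<open>fp_rel\<close> does not exclude, are sent to the unit so that every word has a value.\<close>

lemma free_product_hom:
  assumes G: "group G" and H: "group H" and M: "monoid M"
    and \<alpha>: "\<alpha> \<in> hom G M" "\<alpha> \<one>\<^bsub>G\<^esub> = \<one>\<^bsub>M\<^esub>" and \<beta>: "\<beta> \<in> hom H M" "\<beta> \<one>\<^bsub>H\<^esub> = \<one>\<^bsub>M\<^esub>"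
  obtains \<pi> where "\<pi> \<in> hom (free_product G H) M"
    "\<And>a. a \<in> carrier G \<Longrightarrow> \<pi> (fp_class G H [Inl a]) = \<alpha> a"
    "\<And>b. b \<in> carrier H \<Longrightarrow> \<pi> (fp_class G H [Inr b]) = \<beta> b"
proof -
  interpret G: group G by fact
  interpret H: group H by fact
  interpret M: monoid M by fact
  let ?W = "lists (carrier G <+> carrier H)"
  define letter where "letter l = (case l of Inl a \<Rightarrow> if a \<in> carrier G then \<alpha> a else \<one>\<^bsub>M\<^esub>
    | Inr b \<Rightarrow> if b \<in> carrier H then \<beta> b else \<one>\<^bsub>M\<^esub>)" for l
  define val where "val xs = foldr (\<lambda>l m. letter l \<otimes>\<^bsub>M\<^esub> m) xs \<one>\<^bsub>M\<^esub>" for xs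
  have letter: "letter l \<in> carrier M" for l
    by (auto simp: letter_def hom_in_carrier[OF \<alpha>(1)] hom_in_carrier[OF \<beta>(1)] split: sum.split)
  have val: "val [] = \<one>\<^bsub>M\<^esub>" "val (l # xs) = letter l \<otimes>\<^bsub>M\<^esub> val xs" for l xs
    by (simp_all add: val_def)
  have val_closed: "val xs \<in> carrier M" for xs
    by (induction xs) (auto simp: val letter)
  have val_append: "val (xs @ ys) = val xs \<otimes>\<^bsub>M\<^esub> val ys" for xs ys
    by (induction xs) (auto simp: val letter val_closed M.m_assoc)
  have val_rel: "val xs = val ys" if "fp_rel G H xs ys" for xs ys
    using that
  proof induction
    case (mult_left a b xs ys)
    then have "letter (Inl (a \<otimes>\<^bsub>G\<^esub> b)) = letter (Inl a) \<otimes>\<^bsub>M\<^esub> letter (Inl b)"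
      by (simp add: letter_def hom_mult[OF \<alpha>(1)])
    then show ?case by (simp add: val_append val letter val_closed M.m_assoc)
  next
    case (mult_right a b xs ys)
    then have "letter (Inr (a \<otimes>\<^bsub>H\<^esub> b)) = letter (Inr a) \<otimes>\<^bsub>M\<^esub> letter (Inr b)"
      by (simp add: letter_def hom_mult[OF \<beta>(1)])
    then show ?case by (simp add: val_append val letter val_closed M.m_assoc)
  next
    case (one_left xs ys)
    have "letter (Inl \<one>\<^bsub>G\<^esub>) = \<one>\<^bsub>M\<^esub>" by (simp add: letter_def \<alpha>)
    then show ?case by (simp add: val_append val val_closed)
  next
    case (one_right xs ys)
    have "letter (Inr \<one>\<^bsub>H\<^esub>) = \<one>\<^bsub>M\<^esub>" by (simp add: letter_def \<beta>)
    then show ?case by (simp add: val_append val val_closed)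
  qed simp_all
  define \<pi> where "\<pi> C = val (SOME xs. xs \<in> C)" for C
  have \<pi>: "\<pi> (fp_class G H xs) = val xs" if "xs \<in> ?W" for xs
  proof -
    have "xs \<in> fp_class G H xs" using that by (simp add: fp_class_def fp_rel.refl)
    then have "(SOME ys. ys \<in> fp_class G H xs) \<in> fp_class G H xs" by (rule someI)
    then show ?thesis by (auto simp: \<pi>_def fp_class_def dest: val_rel)
  qed
  show thesis
  proof (rule that[of \<pi>])
    have c: "carrier (free_product G H) = fp_class G H ` ?W"
      by (simp add: free_product_def)
    show "\<pi> \<in> hom (free_product G H) M"
    proof (rule homI)
      show "\<pi> C \<in> carrier M" if "C \<in> carrier (free_product G H)" for C
        by (simp add: \<pi>_def val_closed)
      fix C D assume "C \<in> carrier (free_product G H)" "D \<in> carrier (free_product G H)"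
      then obtain xs ys where "xs \<in> ?W" "C = fp_class G H xs" "ys \<in> ?W" "D = fp_class G H ys"
        by (auto simp only: c)
      moreover from this have "xs @ ys \<in> ?W" by simp
      ultimately show "\<pi> (C \<otimes>\<^bsub>free_product G H\<^esub> D) = \<pi> C \<otimes>\<^bsub>M\<^esub> \<pi> D"
        by (simp only: fp_class_mult \<pi> val_append)
    qed
    show "\<pi> (fp_class G H [Inl a]) = \<alpha> a" if "a \<in> carrier G" for a
      using that \<pi>[of "[Inl a]"] hom_in_carrier[OF \<alpha>(1)] by (simp add: val letter_def InlI)
    show "\<pi> (fp_class G H [Inr b]) = \<beta> b" if "b \<in> carrier H" for b
      using that \<pi>[of "[Inr b]"] hom_in_carrier[OF \<beta>(1)] by (simp add: val letter_def InrI)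
  qed
qed

lemma monoid_unitary_group: "monoid (unitary_group n)"
proof (rule monoidI)
  have c: "carrier (unitary_group n) = {U. unitary_op n U}" "\<one>\<^bsub>unitary_group n\<^esub> = idop n"
    "U \<otimes>\<^bsub>unitary_group n\<^esub> V = U o\<^sub>L V" for U V
    by (auto simp: unitary_group_def unitary_op_def)
  fix U V W
  show "\<one>\<^bsub>unitary_group n\<^esub> \<in> carrier (unitary_group n)"
    by (simp add: c unitary_op_def bop_idop bopD(2)[OF bop_idop])
  assume "U \<in> carrier (unitary_group n)"
  then have U: "U \<in> bop n n" "adj U o\<^sub>L U = idop n" "U o\<^sub>L adj U = idop n"
    by (auto simp: c unitary_op_def)
  then show "\<one>\<^bsub>unitary_group n\<^esub> \<otimes>\<^bsub>unitary_group n\<^esub> U = U" "U \<otimes>\<^bsub>unitary_group n\<^esub> \<one>\<^bsub>unitary_group n\<^esub> = U"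
    by (simp_all add: c bopD(2,3))
  assume "V \<in> carrier (unitary_group n)"
  then have V: "V \<in> bop n n" "adj V o\<^sub>L V = idop n" "V o\<^sub>L adj V = idop n"
    by (auto simp: c unitary_op_def)
  have "adj (U o\<^sub>L V) o\<^sub>L (U o\<^sub>L V) = adj V o\<^sub>L ((adj U o\<^sub>L U) o\<^sub>L V)"
    "(U o\<^sub>L V) o\<^sub>L adj (U o\<^sub>L V) = U o\<^sub>L ((V o\<^sub>L adj V) o\<^sub>L adj U)"
    by (simp_all add: adj_comp bopD(1)[OF U(1)] bopD(1)[OF V(1)] op_assoc)
  then show "U \<otimes>\<^bsub>unitary_group n\<^esub> V \<in> carrier (unitary_group n)"
    by (simp add: c unitary_op_def bop_comp[OF U(1) V(1)] U V bopD(3)[OF V(1)]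
      bopD(3)[OF bop_adj[OF U(1)]])
  show "U \<otimes>\<^bsub>unitary_group n\<^esub> V \<otimes>\<^bsub>unitary_group n\<^esub> W = U \<otimes>\<^bsub>unitary_group n\<^esub> (V \<otimes>\<^bsub>unitary_group n\<^esub> W)"
    by (simp add: c op_assoc)
qed


section \<open>Matrices as operators\<close>

lift_definition matrix_unit :: "nat \<Rightarrow> nat \<Rightarrow> op" is "\<lambda>i j x. scaleC (coord x j) (basis_vec i)"
proof (rule bounded_linear_intro)
  fix i j x y r
  show "scaleC (coord (x + y) j) (basis_vec i) = scaleC (coord x j) (basis_vec i) + scaleC (coord y j) (basis_vec i)"
    by (simp add: plus_ell2.rep_eq scaleC_simps)
  show "scaleC (coord (r *\<^sub>R x) j) (basis_vec i) = r *\<^sub>R scaleC (coord x j) (basis_vec i)"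
    by (simp add: scaleR_scaleC scaleC.rep_eq scaleC_simps)
  show "norm (scaleC (coord x j) (basis_vec i)) \<le> norm x * (norm (basis_vec j) * norm (basis_vec i))"
    using mult_right_mono[OF norm_cinner[of "basis_vec j" x], of "norm (basis_vec i)"]
    by (simp add: norm_scaleC cinner_basis_left mult_ac)
qed

definition mat_op :: "nat \<Rightarrow> (nat \<Rightarrow> nat \<Rightarrow> complex) \<Rightarrow> op" where
  "mat_op n M = (\<Sum>i<n. \<Sum>j<n. scale_op (M i j) (matrix_unit i j))"

lemma coord_sum: "coord (sum f A) i = (\<Sum>a\<in>A. coord (f a) i)"
  by (simp only: cinner_basis_left[symmetric] cinner_sum_right)

lemma coord_mat_op:
  "coord (mat_op n M x) i = (if i < n then \<Sum>j<n. M i j * coord x j else 0)"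
proof -
  have "coord (mat_op n M x) i = (\<Sum>l<n. \<Sum>j<n. M l j * coord x j * (if i = l then 1 else 0))"
    by (simp add: mat_op_def blinfun.sum_left coord_sum scale_op_apply matrix_unit.rep_eq
      scaleC.rep_eq basis_vec.rep_eq mult.assoc)
  also have "\<dots> = (\<Sum>l<n. if i = l then \<Sum>j<n. M l j * coord x j else 0)"
    by (intro sum.cong) auto
  finally show ?thesis by simp
qed

lemma mat_op_bop: "mat_op n M \<in> bop (enat n) (enat n)"
proof (rule bopI)
  show "clinear_op (mat_op n M)"
    unfolding clinear_op_def
    by (intro allI ell2_eqI) (simp add: coord_mat_op scaleC.rep_eq sum_distrib_left mult_ac)
qed (intro ell2_eqI, simp add: coord_mat_op trunc.rep_eq)+

lemma adj_mat_op: "adj (mat_op n M) = mat_op n (\<lambda>i j. cnj (M j i))"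
proof (rule adjI)
  have *: "cinner x (mat_op n M y) = (\<Sum>i<n. \<Sum>j<n. M i j * coord y j * cnj (coord x i))" for M x y
    by (simp add: mat_op_def blinfun.sum_left cinner_sum_right scale_op_apply matrix_unit.rep_eq
      cinner_scaleC_right cinner_basis_right mult.assoc)
  show "cinner (mat_op n M x) y = cinner x (mat_op n (\<lambda>i j. cnj (M j i)) y)" for x y
    by (subst cinner_cnj, unfold *, subst sum.swap) (simp add: mult_ac)
qed

lemma mat_op_cong: "(\<And>i j. i < n \<Longrightarrow> j < n \<Longrightarrow> M i j = M' i j) \<Longrightarrow> mat_op n M = mat_op n M'"
  unfolding mat_op_def by (intro sum.cong HOL.refl) simp


section \<open>An irreducible pair of unitaries in every dimension\<close>

text \<open>The basis vectors are linked into the chain \<open>0 - 1 - 2 - 3 - \<dots>\<close>. The involution \<open>v\<close> acts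
  along the links \<open>{0, 1}, {2, 3}, \<dots>\<close> and the unitary \<open>w\<close> along the links \<open>{1, 2}, {3, 4}, \<dots>\<close>.\<close>

definition vpair :: "nat \<Rightarrow> nat" where
  "vpair i = (if even i then Suc i else i - 1)"

text \<open>The index \<open>0\<close> has no partner, so it is treated separately below.\<close>

definition wpair :: "nat \<Rightarrow> nat" where
  "wpair i = (if odd i then Suc i else i - 1)"

lemma vpair: "vpair (vpair i) = i" "vpair i \<noteq> i"
  by (auto simp: vpair_def elim: oddE)

lemma wpair: "i \<noteq> 0 \<Longrightarrow> wpair (wpair i) = i" "i \<noteq> 0 \<Longrightarrow> wpair i \<noteq> i" "i \<noteq> 0 \<Longrightarrow> wpair i \<noteq> 0"
  by (auto simp: wpair_def elim: oddE evenE)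

text \<open>An index whose partner lies outside the first \<open>n\<close> indices is left alone.\<close>

definition swap_op :: "nat \<Rightarrow> op" where
  "swap_op n = mat_op n (\<lambda>i j. if j = (if vpair i < n then vpair i else i) then 1 else 0)"

text \<open>On each link the block is \<open>1 + (a - 1) p\<close>, where \<open>p\<close> is the projection onto the multiples of
  \<open>e\<^sub>i + e\<^sub>j\<close>, so it has the eigenvalues \<open>1\<close> and \<open>a\<close> without being diagonal. The vector
  \<open>e\<^sub>0\<close> is an eigenvector for \<open>b\<close>. In this parametrization products are taken in \<open>a\<close> and
  \<open>b\<close> separately.\<close>

definition mixing_op :: "nat \<Rightarrow> complex \<Rightarrow> complex \<Rightarrow> op" where
  "mixing_op n a b = mat_op n (\<lambda>i j.
     if i = 0 then if j = 0 then b else 0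
     else if wpair i < n then if j = i then (1 + a) / 2 else if j = wpair i then (a - 1) / 2 else 0
     else if j = i then 1 else 0)"

lemma coord_swap_op:
  "coord (swap_op n x) i = (if i < n then coord x (if vpair i < n then vpair i else i) else 0)"
  by (simp add: swap_op_def coord_mat_op if_distrib[of "\<lambda>c. c * _"] cong: if_cong)

lemma coord_mixing_op:
  "coord (mixing_op n a b x) i = (if i < n then
     if i = 0 then b * coord x 0
     else if wpair i < n then (1 + a) / 2 * coord x i + (a - 1) / 2 * coord x (wpair i)
     else coord x i else 0)"
proof (cases "i < n \<and> i \<noteq> 0 \<and> wpair i < n")
  case True
  have "(\<Sum>j<n. (if j = i then (1 + a) / 2 else if j = wpair i then (a - 1) / 2 else 0) * coord x j)
      = (\<Sum>j<n. (if j = i then (1 + a) / 2 * coord x j else 0)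
          + (if j = wpair i then (a - 1) / 2 * coord x j else 0))"
    using wpair(2)[of i] True by (intro sum.cong) auto
  also have "\<dots> = (1 + a) / 2 * coord x i + (a - 1) / 2 * coord x (wpair i)"
    using True by (simp add: sum.distrib)
  finally show ?thesis using True by (simp add: mixing_op_def coord_mat_op)
qed (auto simp: mixing_op_def coord_mat_op if_distrib[of "\<lambda>c. c * _"] cong: if_cong)

lemma swap_op_involution: "swap_op n o\<^sub>L swap_op n = idop (enat n)"
  by (intro blinfun_eqI ell2_eqI) (auto simp: coord_swap_op idop.rep_eq trunc.rep_eq vpair)

lemma adj_swap_op: "adj (swap_op n) = swap_op n"
  unfolding swap_op_def adj_mat_op by (rule mat_op_cong) (auto simp: vpair)

lemma mixing_op_mult: "mixing_op n a b o\<^sub>L mixing_op n c d = mixing_op n (a * c) (b * d)"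
  by (intro blinfun_eqI ell2_eqI) (auto simp: coord_mixing_op wpair field_simps)

lemma mixing_op_one: "mixing_op n 1 1 = idop (enat n)"
  by (intro blinfun_eqI ell2_eqI) (auto simp: coord_mixing_op idop.rep_eq trunc.rep_eq)

lemma adj_mixing_op: "adj (mixing_op n a b) = mixing_op n (cnj a) (cnj b)"
  unfolding mixing_op_def adj_mat_op by (rule mat_op_cong) (auto simp: wpair)

lemma unitary_swap_op: "unitary_op (enat n) (swap_op n)"
  unfolding unitary_op_def adj_swap_op swap_op_involution by (simp add: swap_op_def mat_op_bop)

lemma unitary_mixing_op:
  assumes "cmod a = 1" "cmod b = 1"
  shows "unitary_op (enat n) (mixing_op n a b)"
proof -
  have "cnj a * a = 1" "cnj b * b = 1" "a * cnj a = 1" "b * cnj b = 1"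
    using assms complex_norm_square[of a] complex_norm_square[of b] by (simp_all add: mult.commute)
  then show ?thesis
    unfolding unitary_op_def adj_mixing_op mixing_op_mult
    by (simp add: mixing_op_one) (simp add: mixing_op_def mat_op_bop)
qed

text \<open>On a link the sum of the two coordinates is multiplied by \<open>a\<close> and their difference by \<open>1\<close>, so
  neither can survive in an eigenvector for \<open>b\<close>.\<close>

lemma mixing_eigenvector:
  assumes "n \<ge> 1" "trunc (enat n) z = z" and ev: "mixing_op n a b z = scaleC b z"
    and ab: "b \<noteq> 1" "b \<noteq> a"
  shows "z = scaleC (coord z 0) (basis_vec 0)"
proof -
  have z: "coord z i = 0" if "i \<noteq> 0" "i < n" for i
  proof -
    have e: "coord (mixing_op n a b z) j = b * coord z j" for j
      by (simp add: ev scaleC.rep_eq)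
    show ?thesis
    proof (cases "wpair i < n")
      case True
      let ?x = "coord z i" and ?y = "coord z (wpair i)"
      have "(1 + a) / 2 * ?x + (a - 1) / 2 * ?y = b * ?x"
        "(1 + a) / 2 * ?y + (a - 1) / 2 * ?x = b * ?y"
        using e[of i] e[of "wpair i"] that True by (simp_all add: coord_mixing_op wpair)
      from this[THEN arg_cong[of _ _ "\<lambda>t. 2 * t"]]
      have 1: "(1 + a) * ?x + (a - 1) * ?y = 2 * (b * ?x)"
        and 2: "(1 + a) * ?y + (a - 1) * ?x = 2 * (b * ?y)"
        by (simp_all only: distrib_left) simp_all
      have "(a - b) * (?x + ?y) = 0" "(1 - b) * (?x - ?y) = 0"
        using 1 2 by algebra+
      with ab have "?x + ?y = 0" "?x = ?y" by auto
      then show ?thesis by simp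
    next
      case False
      then show ?thesis using e[of i] that ab by (simp add: coord_mixing_op)
    qed
  qed
  moreover have "coord z i = 0" if "i \<ge> n" for i
    using assms(2) that by (metis trunc.rep_eq enat_ord_simps(2) not_le)
  ultimately show ?thesis
    by (intro ell2_eqI) (auto simp: coord_simps not_less[symmetric])
qed

text \<open>As \<open>b\<close> is a simple eigenvalue of \<open>w\<close>, an operator \<open>A\<close> in the commutant has \<open>e\<^sub>0\<close> as
  eigenvector, say for \<open>c\<close>. The kernel of \<open>A - c\<close> is invariant under \<open>v\<close> and \<open>w\<close>, and alternating
  these two operators walks from \<open>e\<^sub>0\<close> along the chain through all basis vectors.\<close>

lemma commutant_trivial:
  assumes n: "n \<ge> 1" and A: "A \<in> bop (enat n) (enat n)"
    and W: "A o\<^sub>L mixing_op n a b = mixing_op n a b o\<^sub>L A"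
    and V: "A o\<^sub>L swap_op n = swap_op n o\<^sub>L A"
    and ab: "a \<noteq> 1" "b \<noteq> 1" "b \<noteq> a"
  shows "\<exists>c. A = scale_op c (idop (enat n))"
proof -
  have lin: "A (scaleC d x) = scaleC d (A x)" for d x
    using bopD(1)[OF A] by (simp add: clinear_op_def)
  have W': "A (mixing_op n a b x) = mixing_op n a b (A x)"
    and V': "A (swap_op n x) = swap_op n (A x)" for x
    using arg_cong[OF W, of "\<lambda>T. blinfun_apply T x"] arg_cong[OF V, of "\<lambda>T. blinfun_apply T x"]
    by simp_all
  have Wlin: "mixing_op n a b (scaleC d x) = scaleC d (mixing_op n a b x)"
    and Vlin: "swap_op n (scaleC d x) = scaleC d (swap_op n x)" for d x
    using bopD(1)[OF mat_op_bop] by (simp_all add: clinear_op_def mixing_op_def swap_op_def)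
  define c where "c = coord (A (basis_vec 0)) 0"
  have "mixing_op n a b (basis_vec 0) = scaleC b (basis_vec 0)"
    using n by (intro ell2_eqI) (auto simp: coord_mixing_op coord_simps wpair)
  then have "mixing_op n a b (A (basis_vec 0)) = scaleC b (A (basis_vec 0))"
    by (simp add: W'[symmetric] lin)
  then have c0: "A (basis_vec 0) = scaleC c (basis_vec 0)"
    unfolding c_def by (rule mixing_eigenvector[OF n bopD(5)[OF A] _ ab(2,3)])
  have basis: "i < n \<Longrightarrow> A (basis_vec i) = scaleC c (basis_vec i)" for i
  proof (induction i)
    case (Suc i)
    then have IH: "A (basis_vec i) = scaleC c (basis_vec i)" by simp
    show ?case
    proof (cases "even i")
      case True
      then have "basis_vec (Suc i) = swap_op n (basis_vec i)"
        using Suc.prems by (intro ell2_eqI) (auto simp: coord_swap_op basis_vec.rep_eq vpair_def)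
      then show ?thesis by (simp add: V' IH Vlin)
    next
      case False
      \<comment> \<open>the block of \<open>w\<close> has off-diagonal entry \<open>(a - 1) / 2\<close>, which is nonzero\<close>
      then have "basis_vec (Suc i) = scaleC (2 / (a - 1)) (mixing_op n a b (basis_vec i)
          - scaleC ((1 + a) / 2) (basis_vec i))"
        using Suc.prems ab(1)
        by (intro ell2_eqI) (auto simp: coord_mixing_op coord_simps wpair_def elim: oddE)
      then show ?thesis
        by (simp add: lin blinfun.diff_right W' IH Wlin scaleC_simps mult_ac
          linear_diff[OF bounded_linear.linear[OF bounded_linear_scaleC]])
    qed
  qed (rule c0)
  have "A = scale_op c (idop (enat n))"
  proof (rule blinfun_eqI)
    fix x
    have "A x = A (trunc (enat n) x)" by (simp add: bopD(4)[OF A])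
    also have "\<dots> = (\<Sum>i<n. scaleC c (scaleC (coord x i) (basis_vec i)))"
      by (simp add: trunc_enat_sum blinfun.sum_right lin basis scaleC_simps mult.commute)
    also have "\<dots> = scaleC c (trunc (enat n) x)"
      by (simp add: trunc_enat_sum linear_sum[OF bounded_linear.linear[OF bounded_linear_scaleC]])
    finally show "A x = scale_op c (idop (enat n)) x"
      by (simp add: scale_op_apply idop.rep_eq)
  qed
  then show ?thesis ..
qed


section \<open>Extreme points at every finite level\<close>

text \<open>The intertwining equations are linear in the map, so they pass from \<open>S\<close> to its span; outside of the
  span both maps vanish.\<close>

lemma intertwines_cspan:
  assumes \<phi>: "ucp A (cspan S) n \<phi>" and \<psi>: "ucp A (cspan S) m \<psi>" and \<gamma>: "\<gamma> \<in> bop n m"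
    and S: "\<And>a. a \<in> S \<Longrightarrow> intertwines \<gamma> \<phi> \<psi> a"
  shows "intertwines \<gamma> \<phi> \<psi> a"
proof (cases "a \<in> cspan S")
  case False
  then show ?thesis by (simp add: intertwines_def ucpD(1)[OF \<phi>] ucpD(1)[OF \<psi>])
next
  case True
  note cl = bopD(1)[OF \<gamma>] clinear_adj[OF bopD(1)[OF \<gamma>]]
  have "a \<in> cspan S \<and> intertwines \<gamma> \<phi> \<psi> a"
    using True[unfolded cspan_def]
  proof (induction rule: fam.span_induct_alt)
    case base
    have "scale_op 0 T = 0" for T by (intro blinfun_eqI) (simp add: scale_op_apply)
    then have "\<phi> 0 = 0" "\<psi> 0 = 0"
      using ucpD(4)[OF \<phi> cspan_zero, of 0] ucpD(4)[OF \<psi> cspan_zero, of 0] by simp_all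
    with cspan_zero[of S] show ?case by (simp add: intertwines_def zero_fun_def)
  next
    case (step c s b)
    then have s: "s \<in> cspan S" "scale_fam c s \<in> cspan S" and b: "b \<in> cspan S"
      by (auto intro: cspan_base cspan_scale)
    have int_s: "\<psi> s (\<gamma> z) = \<gamma> (\<phi> s z)" "adj \<gamma> (\<psi> s y) = \<phi> s (adj \<gamma> y)" for z y
      using S[OF step(1)] by (metis intertwines_def blinfun_apply_blinfun_compose)+
    have int_b: "\<psi> b (\<gamma> z) = \<gamma> (\<phi> b z)" "adj \<gamma> (\<psi> b y) = \<phi> b (adj \<gamma> y)" for z y
      using step(2) by (metis intertwines_def blinfun_apply_blinfun_compose)+
    have "intertwines \<gamma> \<phi> \<psi> (scale_fam c s + b)"
      unfolding intertwines_def
      by (intro conjI blinfun_eqI)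
        (use cl in \<open>simp_all add: ucpD(3)[OF \<phi> s(2) b] ucpD(3)[OF \<psi> s(2) b] ucpD(4)[OF \<phi> s(1)]
          ucpD(4)[OF \<psi> s(1)] blinfun.add_left blinfun.add_right scale_op_apply int_s int_b clinear_op_def\<close>)
    with cspan_add[OF s(2) b] show ?case by (simp add: plus_fun_def)
  qed
  then show ?thesis ..
qed

text \<open>The condition \<open>k \<ge> 3\<close> enters here: there are three distinct \<open>k\<close>-th roots of unity
  \<open>1, \<omega>, \<omega>\<^sup>2\<close>. It suffices that \<open>\<omega>\<close> is not real.\<close>

lemma root_of_unity_facts:
  assumes "k \<ge> 3"
  defines "\<omega> \<equiv> cis (2 * pi / real k)"
  shows "\<omega> ^ k = 1" "\<omega> \<noteq> 1" "\<omega>\<^sup>2 \<noteq> 1" "\<omega>\<^sup>2 \<noteq> \<omega>" "cmod \<omega> = 1"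
proof -
  show "\<omega> ^ k = 1" unfolding \<omega>_def Complex.DeMoivre using assms(1) by simp
  have "0 < sin (2 * pi / real k)"
    using assms by (intro sin_gt_zero) (simp_all add: field_simps)
  then have "Im \<omega> \<noteq> 0" by (simp add: \<omega>_def)
  then show "\<omega> \<noteq> 1" "\<omega>\<^sup>2 \<noteq> 1" by (auto simp only: power2_eq_1_iff) auto
  with \<open>Im \<omega> \<noteq> 0\<close> show "\<omega>\<^sup>2 \<noteq> \<omega>" by (auto simp: power2_eq_square)
  show "cmod \<omega> = 1" by (simp add: \<omega>_def)
qed

definition class_w :: "nat \<Rightarrow> (int + int) list set" where
  "class_w k = fp_class (integer_mod_group k) (integer_mod_group 2) [Inl 1]"

definition class_v :: "nat \<Rightarrow> (int + int) list set" where
  "class_v k = fp_class (integer_mod_group k) (integer_mod_group 2) [Inr 1]"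

lemma gen_eq: "gen_w k = group_unitary (Zk_Z2 k) (class_w k)" "gen_v k = group_unitary (Zk_Z2 k) (class_v k)"
  by (simp_all add: gen_w_def gen_v_def class_w_def class_v_def)

lemma group_Zk_Z2: "group (Zk_Z2 k)"
  by (simp add: Zk_Z2_def group_free_product)

lemma class_in_carrier:
  assumes "k \<ge> 3"
  shows "class_w k \<in> carrier (Zk_Z2 k)" "class_v k \<in> carrier (Zk_Z2 k)"
proof -
  have c: "carrier (Zk_Z2 k) = fp_class (integer_mod_group k) (integer_mod_group 2)
      ` lists (carrier (integer_mod_group k) <+> carrier (integer_mod_group 2))"
    by (simp add: Zk_Z2_def free_product_def)
  show "class_w k \<in> carrier (Zk_Z2 k)" "class_v k \<in> carrier (Zk_Z2 k)"
    unfolding c class_w_def class_v_def using assms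
    by (simp_all add: imageI InlI InrI)
qed

lemma class_w_pow:
  assumes "k \<ge> 3"
  shows "class_w k [^]\<^bsub>Zk_Z2 k\<^esub> i
    = fp_class (integer_mod_group k) (integer_mod_group 2) [Inl (int i mod int k)]"
proof (induction i)
  let ?F = "fp_class (integer_mod_group k) (integer_mod_group 2)"
  interpret group "Zk_Z2 k" by (rule group_Zk_Z2)
  case 0
  have "?F [] = ?F [Inl 0]"
    using fp_rel.one_left[of "integer_mod_group k" "integer_mod_group 2" "[]" "[]"]
    by (simp add: fp_class_eqI[OF fp_rel.sym])
  then show ?case by (simp add: Zk_Z2_def free_product_def)
next
  let ?F = "fp_class (integer_mod_group k) (integer_mod_group 2)"
  interpret group "Zk_Z2 k" by (rule group_Zk_Z2)
  case (Suc i)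
  have car: "int i mod int k \<in> carrier (integer_mod_group k)" "1 \<in> carrier (integer_mod_group k)"
    using assms by (auto simp: carrier_integer_mod_group)
  have "class_w k [^]\<^bsub>Zk_Z2 k\<^esub> Suc i = class_w k [^]\<^bsub>Zk_Z2 k\<^esub> i \<otimes>\<^bsub>Zk_Z2 k\<^esub> class_w k"
    by simp
  also have "\<dots> = ?F ([Inl (int i mod int k)] @ [Inl 1])"
    unfolding Suc unfolding class_w_def Zk_Z2_def
    by (rule fp_class_mult) (use car in \<open>auto intro: InlI\<close>)
  also have "\<dots> = ?F [Inl ((int i mod int k + 1) mod int k)]"
    using fp_rel.mult_left[OF car, of "integer_mod_group 2" "[]" "[]"] by (intro fp_class_eqI) simp
  also have "(int i mod int k + 1) mod int k = int (Suc i) mod int k"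
    by (simp add: mod_simps add.commute)
  finally show ?case .
qed

lemma class_w_pow_k:
  assumes "k \<ge> 3"
  shows "class_w k [^]\<^bsub>Zk_Z2 k\<^esub> k = \<one>\<^bsub>Zk_Z2 k\<^esub>"
  using class_w_pow[OF assms, of k] class_w_pow[OF assms, of 0] by simp

lemma class_v_involution:
  assumes "k \<ge> 3"
  shows "class_v k \<otimes>\<^bsub>Zk_Z2 k\<^esub> class_v k = \<one>\<^bsub>Zk_Z2 k\<^esub>"
proof -
  let ?F = "fp_class (integer_mod_group k) (integer_mod_group 2)"
  have car: "1 \<in> carrier (integer_mod_group 2)" by (simp add: carrier_integer_mod_group)
  have "class_v k \<otimes>\<^bsub>Zk_Z2 k\<^esub> class_v k = ?F ([Inr 1] @ [Inr 1])"
    unfolding class_v_def Zk_Z2_def by (rule fp_class_mult) (use car in \<open>auto intro: InrI\<close>)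
  also have "\<dots> = ?F [Inr 0]"
    using fp_rel.mult_right[OF car car, of "integer_mod_group k" "[]" "[]"]
    by (intro fp_class_eqI) simp
  also have "\<dots> = ?F []"
    using fp_rel.one_right[of "integer_mod_group k" "integer_mod_group 2" "[]" "[]"]
    by (intro fp_class_eqI) simp
  finally show ?thesis by (simp add: Zk_Z2_def free_product_def)
qed

text \<open>The operator system \<open>NCP k\<close> is spanned by a self-adjoint set of unitaries; this is required to
  apply \<open>ucp_contraction\<close> to each of them.\<close>

lemma star_gen_w_pow:
  assumes "k \<ge> 3" "i < k"
  shows "\<exists>j<k. star (group_unitary (Zk_Z2 k) (class_w k [^]\<^bsub>Zk_Z2 k\<^esub> i))
    = group_unitary (Zk_Z2 k) (class_w k [^]\<^bsub>Zk_Z2 k\<^esub> j)"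
proof -
  interpret group "Zk_Z2 k" by (rule group_Zk_Z2)
  note w = class_in_carrier(1)[OF assms(1)]
  show ?thesis
  proof (cases "i = 0")
    case True
    then show ?thesis using assms w by (intro exI[of _ 0]) (simp add: star_group_unitary[OF is_group])
  next
    case False
    have "class_w k [^]\<^bsub>Zk_Z2 k\<^esub> (k - i) \<otimes>\<^bsub>Zk_Z2 k\<^esub> class_w k [^]\<^bsub>Zk_Z2 k\<^esub> i = \<one>\<^bsub>Zk_Z2 k\<^esub>"
      using assms w by (simp add: nat_pow_mult class_w_pow_k)
    then have "inv\<^bsub>Zk_Z2 k\<^esub> (class_w k [^]\<^bsub>Zk_Z2 k\<^esub> i) = class_w k [^]\<^bsub>Zk_Z2 k\<^esub> (k - i)"
      using w by (intro inv_equality) auto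
    then show ?thesis
      using assms w False by (intro exI[of _ "k - i"]) (simp add: star_group_unitary[OF is_group])
  qed
qed

lemma star_gen_v:
  assumes "k \<ge> 3"
  shows "star (gen_v k) = gen_v k"
proof -
  interpret group "Zk_Z2 k" by (rule group_Zk_Z2)
  note v = class_in_carrier(2)[OF assms]
  have "inv\<^bsub>Zk_Z2 k\<^esub> (class_v k) = class_v k"
    using v class_v_involution[OF assms] by (intro inv_equality) auto
  then show ?thesis using v by (simp add: gen_eq star_group_unitary[OF is_group])
qed

text \<open>The eigenvalues of \<open>w\<close> are the three roots of unity \<open>1\<close>, \<open>a = \<omega>\<close> and \<open>b = \<omega>\<^sup>2\<close>.\<close>

lemma prism_representation:
  assumes "k \<ge> 3" "n \<ge> 1"
  obtains \<pi> a b where "(enat n, \<pi>) \<in> unitary_reps (Zk_Z2 k)"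
    "\<pi> (class_w k) = mixing_op n a b" "\<pi> (class_v k) = swap_op n" "a \<noteq> 1" "b \<noteq> 1" "b \<noteq> a"
proof -
  let ?G = "integer_mod_group k" and ?H = "integer_mod_group 2" and ?M = "unitary_group (enat n)"
  define \<omega> where "\<omega> = cis (2 * pi / real k)"
  note \<omega> = root_of_unity_facts[OF assms(1), folded \<omega>_def]
  define \<alpha> where "\<alpha> x = mixing_op n (\<omega> ^ nat x) ((\<omega>\<^sup>2) ^ nat x)" for x
  define \<beta> where "\<beta> x = (if x = 0 then idop (enat n) else swap_op n)" for x :: int
  have c: "carrier ?M = {U. unitary_op (enat n) U}" "\<one>\<^bsub>?M\<^esub> = idop (enat n)"
    "U \<otimes>\<^bsub>?M\<^esub> V = U o\<^sub>L V" for U V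
    by (auto simp: unitary_group_def unitary_op_def)
  have "\<alpha> \<in> hom ?G ?M"
  proof (rule homI)
    show "\<alpha> x \<in> carrier ?M" for x
      unfolding c \<alpha>_def mem_Collect_eq by (rule unitary_mixing_op) (simp_all add: \<omega> norm_power)
    fix x y assume "x \<in> carrier ?G" "y \<in> carrier ?G"
    then have xy: "x \<ge> 0" "y \<ge> 0" using assms(1) by (auto simp: carrier_integer_mod_group)
    have per: "\<zeta> ^ nat ((x + y) mod int k) = \<zeta> ^ nat x * \<zeta> ^ nat y" if "\<zeta> ^ k = 1" for \<zeta> :: complex
    proof -
      have "\<zeta> ^ (nat x + nat y) = \<zeta> ^ (k * ((nat x + nat y) div k) + (nat x + nat y) mod k)"
        by simp
      also have "\<dots> = \<zeta> ^ ((nat x + nat y) mod k)"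
        unfolding power_add power_mult that by simp
      finally show ?thesis using xy by (simp add: nat_mod_distrib nat_add_distrib power_add)
    qed
    have "(\<omega>\<^sup>2) ^ k = 1" by (metis \<omega>(1) power_mult mult.commute power_one)
    then show "\<alpha> (x \<otimes>\<^bsub>?G\<^esub> y) = \<alpha> x \<otimes>\<^bsub>?M\<^esub> \<alpha> y"
      by (simp add: c \<alpha>_def mixing_op_mult per \<omega>(1))
  qed
  moreover have "\<alpha> \<one>\<^bsub>?G\<^esub> = \<one>\<^bsub>?M\<^esub>" by (simp add: \<alpha>_def c mixing_op_one)
  moreover have "\<beta> \<in> hom ?H ?M"
  proof (rule homI)
    show "\<beta> x \<in> carrier ?M" for x
      using monoid.one_closed[OF monoid_unitary_group, of "enat n"] unitary_swap_op[of n]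
      by (simp add: c \<beta>_def)
    fix x y assume "x \<in> carrier ?H" "y \<in> carrier ?H"
    then have "x = 0 \<or> x = 1" "y = 0 \<or> y = 1" by (auto simp: carrier_integer_mod_group)
    moreover have "swap_op n \<in> bop (enat n) (enat n)" by (simp add: swap_op_def mat_op_bop)
    ultimately show "\<beta> (x \<otimes>\<^bsub>?H\<^esub> y) = \<beta> x \<otimes>\<^bsub>?M\<^esub> \<beta> y"
      by (auto simp: c \<beta>_def swap_op_involution bopD(2,3) bopD(2)[OF bop_idop])
  qed
  moreover have "\<beta> \<one>\<^bsub>?H\<^esub> = \<one>\<^bsub>?M\<^esub>" by (simp add: \<beta>_def c)
  ultimately obtain \<pi> where \<pi>: "\<pi> \<in> hom (free_product ?G ?H) ?M"
    "\<And>a. a \<in> carrier ?G \<Longrightarrow> \<pi> (fp_class ?G ?H [Inl a]) = \<alpha> a"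
    "\<And>b. b \<in> carrier ?H \<Longrightarrow> \<pi> (fp_class ?G ?H [Inr b]) = \<beta> b"
    using free_product_hom[of ?G ?H ?M \<alpha> \<beta>] monoid_unitary_group by auto
  show thesis
  proof (rule that)
    show "(enat n, \<pi>) \<in> unitary_reps (Zk_Z2 k)"
      using \<pi>(1) assms by (simp add: unitary_reps_def Zk_Z2_def zero_enat_def)
    show "\<pi> (class_w k) = mixing_op n \<omega> (\<omega>\<^sup>2)"
      using assms by (simp add: class_w_def \<pi>(2) \<alpha>_def)
    show "\<pi> (class_v k) = swap_op n"
      by (simp add: class_v_def \<pi>(3) \<beta>_def)
  qed (use \<omega> in auto)
qed

lemma NCP_eq:
  assumes "k \<ge> 3"
  shows "NCP k = cspan (insert (gen_v k)
    ((\<lambda>i. group_unitary (Zk_Z2 k) (class_w k [^]\<^bsub>Zk_Z2 k\<^esub> i)) ` {..<k}))"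
proof -
  have "{gen_w k [^]\<^bsub>prism_alg k\<^esub> i | i :: nat. i < k}
      = (\<lambda>i. group_unitary (Zk_Z2 k) (class_w k [^]\<^bsub>Zk_Z2 k\<^esub> i)) ` {..<k}"
    by (auto simp: gen_eq prism_alg_def
      group_unitary_pow[OF group_Zk_Z2 class_in_carrier(1)[OF assms]])
  then show ?thesis by (simp add: NCP_def)
qed

theorem corollary4p7:
  fixes k n :: nat
  assumes "k \<ge> 3" and "n \<ge> 1"
  shows "(\<exists>x. nc_extreme (nc_prism k) (enat n) x) \<and>
    (\<exists>\<phi>. nc_extreme (nc_state_space (prism_alg k) (NCP k)) (enat n) \<phi>)"
proof -
  let ?G = "Zk_Z2 k"
  interpret group ?G by (rule group_Zk_Z2)
  obtain \<pi> a b where rep: "(enat n, \<pi>) \<in> unitary_reps ?G"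
    and \<pi>: "\<pi> (class_w k) = mixing_op n a b" "\<pi> (class_v k) = swap_op n"
    and ab: "a \<noteq> 1" "b \<noteq> 1" "b \<noteq> a"
    using prism_representation[OF assms] by blast
  note G = class_in_carrier[OF assms(1)]
  have n: "enat n \<noteq> 0" using assms(2) by (simp add: zero_enat_def)
  have irr: "\<exists>c. A = scale_op c (idop (enat n))"
    if "A \<in> bop (enat n) (enat n)" "A o\<^sub>L \<pi> (class_w k) = \<pi> (class_w k) o\<^sub>L A"
      "A o\<^sub>L \<pi> (class_v k) = \<pi> (class_v k) o\<^sub>L A" for A
    using that commutant_trivial[OF assms(2) that(1) _ _ ab] by (simp add: \<pi>)
  have val: "group_unitary ?G g (enat n, \<pi>) = \<pi> g" for g
    using rep by (simp add: group_unitary_def)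
  have one: "\<one>\<^bsub>prism_alg k\<^esub> = group_unitary ?G \<one>\<^bsub>?G\<^esub>"
    by (simp add: prism_alg_def full_cstar_def)
  define u where "u = group_unitary ?G"
  define state where "state R = (\<lambda>a. if a \<in> R then a (enat n, \<pi>) else 0)" for R :: "prism_elt set"
  have state: "ucp (prism_alg k) (cspan S) (enat n) (state (cspan S))"
    if "S \<subseteq> u ` carrier ?G" "u \<one>\<^bsub>?G\<^esub> \<in> S" for S
    unfolding prism_alg_def state_def
    by (rule ucp_rep[OF is_group rep])
      (use that in \<open>auto simp: u_def cspan_def fam.span_base fam.span_add fam.span_scale
        intro: subsetD[OF fam.span_mono]\<close>)
  have contr: "contraction (\<psi> (u g))"
    if "ucp (prism_alg k) R m \<psi>" "u \<one>\<^bsub>?G\<^esub> \<in> R" "u g \<in> R" "star (u g) \<in> R" "g \<in> carrier ?G"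
    for \<psi> R m g
    using that unfolding u_def prism_alg_def by (intro ucp_contraction[OF is_group])
  have uni: "unitary_op (enat n) (\<pi> g)" if "g \<in> carrier ?G" for g
    by (rule unitary_repsD(1)[OF is_group rep that])

  define S1 where "S1 = {u \<one>\<^bsub>?G\<^esub>, u (class_w k), star (u (class_w k)), u (class_v k)}"
  define x1 where "x1 = case_bool (\<pi> (class_w k)) (\<pi> (class_v k))"
  have P: "nc_prism k m = (if m = 0 then {} else {case_bool (\<phi> (u (class_w k))) (\<phi> (u (class_v k))) | \<phi>.
      ucp (prism_alg k) (cspan S1) m \<phi>})" for m
    by (simp add: nc_prism_def S1_def gen_eq u_def one)
  have S1: "S1 \<subseteq> u ` carrier ?G" "u \<one>\<^bsub>?G\<^esub> \<in> S1"
    using G by (auto simp: S1_def u_def star_group_unitary[OF is_group])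
  have base1: "c \<in> S1 \<Longrightarrow> c \<in> cspan S1" for c by (rule cspan_base)
  have w1: "u (class_w k) \<in> cspan S1" and v1: "u (class_v k) \<in> cspan S1"
    and sw1: "star (u (class_w k)) \<in> cspan S1"
    by (simp_all add: S1_def cspan_base)
  have prismE: thesis
    if "y \<in> nc_prism k m" "\<And>\<phi>. ucp (prism_alg k) (cspan S1) m \<phi> \<Longrightarrow>
      y = case_bool (\<phi> (u (class_w k))) (\<phi> (u (class_v k))) \<Longrightarrow> thesis" for y m thesis
    using that unfolding P by (cases "m = 0") auto
  have star_v: "star (u (class_v k)) = u (class_v k)"
    using star_gen_v[OF assms(1)] by (simp add: gen_eq u_def)
  interpret prism: unitary_generators "nc_prism k" "enat n" x1 UNIV
  proof
    show "enat n \<noteq> 0" by (rule n)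
    have "x1 = case_bool (state (cspan S1) (u (class_w k))) (state (cspan S1) (u (class_v k)))"
      using w1 v1 by (simp add: x1_def state_def) (simp add: u_def val)
    then show "x1 \<in> nc_prism k (enat n)" using n state[OF S1] unfolding P by auto
    show "unitary_op (enat n) (x1 i)" for i
      using uni G by (cases i) (auto simp: x1_def)
    show "y i \<in> bop m m" if y: "y \<in> nc_prism k m" for y m i
    proof -
      obtain \<phi> where \<phi>: "ucp (prism_alg k) (cspan S1) m \<phi>"
        "y = case_bool (\<phi> (u (class_w k))) (\<phi> (u (class_v k)))"
        using prismE[OF y] .
      show ?thesis using ucpD(2)[OF \<phi>(1) w1] ucpD(2)[OF \<phi>(1) v1] by (cases i) (simp_all add: \<phi>(2))
    qed
    show "contraction (y i)" if y: "y \<in> nc_prism k m" for y m i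
    proof -
      obtain \<phi> where \<phi>: "ucp (prism_alg k) (cspan S1) m \<phi>"
        "y = case_bool (\<phi> (u (class_w k))) (\<phi> (u (class_v k)))"
        using prismE[OF y] .
      have "star (u (class_v k)) \<in> cspan S1" using v1 by (simp add: star_v)
      then have "contraction (\<phi> (u (class_w k)))" "contraction (\<phi> (u (class_v k)))"
        using contr[OF \<phi>(1) base1[OF S1(2)]] w1 v1 sw1 G by auto
      then show ?thesis by (cases i) (simp_all add: \<phi>(2))
    qed
    show "\<exists>c. A = scale_op c (idop (enat n))"
      if "A \<in> bop (enat n) (enat n)" "\<And>i. i \<in> UNIV \<Longrightarrow> A o\<^sub>L x1 i = x1 i o\<^sub>L A" for A
      using irr[OF that(1)] that(2)[of True] that(2)[of False] by (simp add: x1_def)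
    show "compress V y V \<in> nc_prism k m"
      if y: "y \<in> nc_prism k N" and m: "m \<noteq> 0" and V: "isometry_op m N V" for y N m V
    proof -
      obtain \<phi> where \<phi>: "ucp (prism_alg k) (cspan S1) N \<phi>"
        "y = case_bool (\<phi> (u (class_w k))) (\<phi> (u (class_v k)))"
        using prismE[OF y] .
      have "compress V y V = case_bool (compress V \<phi> V (u (class_w k))) (compress V \<phi> V (u (class_v k)))"
        by (auto simp: \<phi>(2) compress_def fun_eq_iff split: bool.split)
      then show ?thesis using m ucp_compress[OF \<phi>(1) V] by (auto simp: P)
    qed
  qed simp

  define S2 where "S2 = insert (u (class_v k)) ((\<lambda>i. u (class_w k [^]\<^bsub>?G\<^esub> i)) ` {..<k})"
  have N: "NCP k = cspan S2" by (simp add: NCP_eq[OF assms(1)] S2_def u_def gen_eq)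
  have one2: "u \<one>\<^bsub>?G\<^esub> \<in> S2"
    using assms(1) by (auto simp: S2_def intro!: image_eqI[of _ _ 0])
  have w2: "u (class_w k) \<in> S2"
    using assms(1) G by (auto simp: S2_def intro!: image_eqI[of _ _ 1])
  have S2: "S2 \<subseteq> u ` carrier ?G"
    using G by (auto simp: S2_def)
  have star2: "star c \<in> S2" if "c \<in> S2" for c
    using that star_v star_gen_w_pow[OF assms(1)] by (fastforce simp: S2_def u_def)
  interpret states: unitary_generators "nc_state_space (prism_alg k) (NCP k)" "enat n" "state (NCP k)" S2
  proof
    show "enat n \<noteq> 0" by (rule n)
    show "state (NCP k) \<in> nc_state_space (prism_alg k) (NCP k) (enat n)"
      using n state[OF S2 one2] by (simp add: nc_state_space_def N)
    show "unitary_op (enat n) (state (NCP k) c)" if c: "c \<in> S2" for c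
    proof -
      obtain g where g: "g \<in> carrier ?G" "c = u g" using subsetD[OF S2 c] by (rule imageE)
      have "state (NCP k) c = c (enat n, \<pi>)"
        using cspan_base[OF c] by (simp add: state_def N)
      also have "\<dots> = \<pi> g" unfolding g(2) u_def by (rule val)
      finally show ?thesis using uni[OF g(1)] by simp
    qed
    show "y c \<in> bop m m" if "y \<in> nc_state_space (prism_alg k) (NCP k) m" for y m c
      using that ucpD(1,2)[of "prism_alg k" "NCP k" m y c] bop_zero
      by (cases "c \<in> NCP k") (auto simp: nc_state_space_def split: if_splits)
    show "contraction (y c)" if y: "y \<in> nc_state_space (prism_alg k) (NCP k) m" and c: "c \<in> S2" for y m c
    proof -
      obtain g where "g \<in> carrier ?G" "c = u g" using subsetD[OF S2 c] by (rule imageE)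
      moreover have "ucp (prism_alg k) (NCP k) m y"
        using y by (auto simp: nc_state_space_def split: if_splits)
      ultimately show ?thesis
        using c star2[OF c] one2 by (auto simp: N intro!: contr cspan_base)
    qed
    show "intertwines \<gamma> (state (NCP k)) y c"
      if "y \<in> nc_state_space (prism_alg k) (NCP k) m" "\<gamma> \<in> bop (enat n) m"
        "\<And>s. s \<in> S2 \<Longrightarrow> intertwines \<gamma> (state (NCP k)) y s" for y m \<gamma> c
    proof (rule intertwines_cspan[OF _ _ that(2,3)])
      show "ucp (prism_alg k) (cspan S2) (enat n) (state (NCP k))"
        using state[OF S2 one2] by (simp add: N)
      show "ucp (prism_alg k) (cspan S2) m y"
        using that(1) by (auto simp: nc_state_space_def N split: if_splits)
    qed
    show "\<exists>c. A = scale_op c (idop (enat n))"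
      if A: "A \<in> bop (enat n) (enat n)"
        "\<And>s. s \<in> S2 \<Longrightarrow> A o\<^sub>L state (NCP k) s = state (NCP k) s o\<^sub>L A" for A
    proof -
      have v2: "u (class_v k) \<in> S2" by (simp add: S2_def)
      have "state (NCP k) (u (class_w k)) = \<pi> (class_w k)" "state (NCP k) (u (class_v k)) = \<pi> (class_v k)"
        using cspan_base[OF w2] cspan_base[OF v2] by (simp_all add: state_def N) (simp_all add: u_def val)
      then show ?thesis using irr[OF A(1)] A(2)[OF w2] A(2)[OF v2] by simp
    qed
    show "compress V y V \<in> nc_state_space (prism_alg k) (NCP k) m"
      if "y \<in> nc_state_space (prism_alg k) (NCP k) M" "m \<noteq> 0" "isometry_op m M V" for y M m V
      using that ucp_compress[of "prism_alg k" "NCP k" M y m V]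
      by (auto simp: nc_state_space_def split: if_splits)
  qed
  show ?thesis using prism.extreme states.extreme by blast
qed

end
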